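(* Let $\Sigma,\Sigma'$ be spatial conjunctions and $s$ a stack with $s\models\mathrm{WellFormed}(\Sigma)$. Then: (i) the procedure $\mathrm{Match}(s,\Sigma,\Sigma,\Sigma')$ always terminates (for any choices made in its nondeterministic steps) with a result $U$ (a pure formula); (ii) the execution requires $O(n)$ recursive steps, where $n=|\Sigma|+|\Sigma'|$; (iii) if $s\models U$ then the entailment $U\land\Sigma\rightarrow\Sigma'$ is valid; (iv) if $s\not\models U$ then $s\not\models\Sigma\rightarrow\Sigma'$, i.e. there exists a heap $h$ with $s,h\models\Sigma$ and $s,h\not\models\Sigma'$.
   Context: Setting: a many-sorted first-order language with sorts including $\mathsf{Int}$ and $\mathsf{Bool}$, equality $\simeq$, classical boolean connectives, and possibly further theory symbols with standard interpretations. Pure = containing no spatial symbol. A stack $s$ maps variables to values of their sorts and is extended to pure expressions. A heap is a partial function $h\colon\mathbb{Z}\rightharpoonup\mathsf{Val}$; $h=h_1\ast\dots\ast h_n$ means $h$ is the union of the $h_i$ with pairwise disjoint domains. Spatial predicates: $\mathrm{emp}$, $\mathrm{next}(x,y)$, $\mathrm{lseg}(x,y)$ with $x,y$ pure $\mathsf{Int}$ expressions. A spatial conjunction $\Sigma=S_1\ast\dots\ast S_n$ ($n\ge0$) is a finite multiset of spatial predicates; $|\Sigma|=n$; $S\in\Sigma$, $\Sigma\setminus S$ (remove one occurrence) and $\ast$ (multiset union) are multiset operations; the empty conjunction denotes $\mathrm{emp}$. Semantics: $s,h\models\Pi$ (pure) iff $s(\Pi)=\top$; $s,h\models\mathrm{emp}$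 iff $h=\emptyset$; $s,h\models\mathrm{next}(x,y)$ iff $h=\{s(x)\mapsto s(y)\}$; $s,h\models F_1\ast F_2$ iff $h=h_1\ast h_2$ with $s,h_i\models F_i$; $s,h\models\mathrm{lseg}(x,z)$ iff there are $n\ge0$ and integers $a_0,\dots,a_n$ with $a_0=s(x)$, $a_n=s(z)$, $a_i\ne s(z)$ for $i<n$ and $h=\{a_0\mapsto a_1\}\ast\dots\ast\{a_{n-1}\mapsto a_n\}$; $\land,\lor,\lnot,\rightarrow$ classical. A formula $F$ is valid if $s,h\models F$ for all stacks $s$ and heaps $h$; $s\models F$ means $s,h\models F$ for every heap $h$. Auxiliary definitions: $\mathrm{Empty}(\mathrm{emp})=\top$, $\mathrm{Empty}(\mathrm{next}(x,y))=\bot$, $\mathrm{Empty}(\mathrm{lseg}(x,y))=(x\simeq y)$; $\mathrm{Addr}(\mathrm{next}(x,y))=\mathrm{Addr}(\mathrm{lseg}(x,y))=x$. $\mathrm{Collide}(S,S')=\lnot\mathrm{Empty}(S)\land\lnot\mathrm{Empty}(S')\land\mathrm{Addr}(S)\simeq\mathrm{Addr}(S')$ ($\bot$ if either is $\mathrm{emp}$). $\mathrm{WellFormed}(S_1\ast\dots\ast S_n)=\bigwedge_{1\le i<j\le n}\lnot\mathrm{Collide}(S_i,S_j)$. $\mathrm{Alloc}(S_1\ast\dots\ast S_n,x)=\bigvee_{1\le i\le n}(\lnot\mathrm{Empty}(S_i)\land x\simeq\mathrm{Addr}(S_i))$. For $S\in\{\mathrm{next}(x,y),\mathrm{lseg}(x,y)\}$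 and $S'\in\{\mathrm{next}(x',z),\mathrm{lseg}(x',z)\}$, $\mathrm{Update}(S,S')$ and $\mathrm{Check}(\hat\Sigma,S,S')$ are: for $(S,S')=(\mathrm{next}(x,y),\mathrm{next}(x',z))$: $\mathrm{emp}$ and $y\simeq z$; for $(\mathrm{next}(x,y),\mathrm{lseg}(x',z))$: $\mathrm{lseg}(y,z)$ and $\top$; for $(\mathrm{lseg}(x,y),\mathrm{next}(x',z))$: $\mathrm{emp}$ and $\bot$; for $(\mathrm{lseg}(x,y),\mathrm{lseg}(x',z))$: $\mathrm{lseg}(y,z)$ and $y\not\simeq z\rightarrow\mathrm{Alloc}(\hat\Sigma,z)$. $\mathrm{Guard}(\hat\Sigma,S,S')=\mathrm{Collide}(S,S')\land\mathrm{Check}(\hat\Sigma,S,S')$ (taken to be $\bot$ if $S$ or $S'$ is $\mathrm{emp}$). The procedure $\mathrm{Match}(s,\hat\Sigma,\Sigma,\Sigma')$ (stack $s$, spatial conjunctions $\hat\Sigma,\Sigma,\Sigma'$) returns a pure formula as follows, where each "if there exists" picks an arbitrary witness: 1. If there is $S\in\Sigma$ with $s\models\mathrm{Empty}(S)$: return $\mathrm{Empty}(S)\land\mathrm{Match}(s,\hat\Sigma,\Sigma\setminus S,\Sigma')$. 2. Else if there is $S'\in\Sigma'$ with $s\models\mathrm{Empty}(S')$: return $\mathrm{Empty}(S')\land\mathrm{Match}(s,\hat\Sigma,\Sigma,\Sigma'\setminus S')$. 3. Else if there are $S\in\Sigma$, $S'\in\Sigma'$ with $s\models\mathrm{Guard}(\hat\Sigma,S,S')$: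 return $\mathrm{Guard}(\hat\Sigma,S,S')\land\mathrm{Match}(s,\hat\Sigma,\Sigma\setminus S,(\Sigma'\setminus S')\ast\mathrm{Update}(S,S'))$. 4. Else return $\top$ if both $\Sigma$ and $\Sigma'$ are empty, and $\bot$ otherwise. *)

theory Defs
  imports Complex_Main "HOL-Library.Multiset" "HOL-Library.Landau_Symbols"
begin

section \<open>The many-sorted pure language\<close>

datatype 'k sort = IntS | BoolS | OtherS 'k

datatype 'd val = IntV (the_int: int) | BoolV bool | OtherV 'd

text \<open>
  A many-sorted signature (variables \<open>'x\<close>, theory symbols \<open>'f\<close>, sorts beyond Int and Bool \<open>'k\<close>)
  together with its fixed standard interpretation. Predicate symbols are function symbols with
  result sort \<^const>\<open>BoolS\<close>.
\<close>

record ('x, 'f, 'k, 'd) language =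
  var_sort :: "'x \<Rightarrow> 'k sort"
  arg_sorts :: "'f \<Rightarrow> 'k sort list"
  res_sort :: "'f \<Rightarrow> 'k sort"
  carrier :: "'k \<Rightarrow> 'd set"
  interp :: "'f \<Rightarrow> 'd val list \<Rightarrow> 'd val"

fun vals :: "('x, 'f, 'k, 'd) language \<Rightarrow> 'k sort \<Rightarrow> 'd val set" where
  "vals L IntS = range IntV"
| "vals L BoolS = range BoolV"
| "vals L (OtherS k) = OtherV ` carrier L k"

definition is_language :: "('x, 'f, 'k, 'd) language \<Rightarrow> bool" where
  "is_language L \<longleftrightarrow>
     (\<forall>k. carrier L k \<noteq> {}) \<and>
     (\<forall>f vs. list_all2 (\<lambda>v \<tau>. v \<in> vals L \<tau>) vs (arg_sorts L f) \<longrightarrow>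
        interp L f vs \<in> vals L (res_sort L f))"

datatype ('x, 'f) expr =
    Var 'x
  | App 'f "('x, 'f) expr list"
  | PEq "('x, 'f) expr" "('x, 'f) expr"
  | PTrue
  | PFalse
  | PNot "('x, 'f) expr"
  | PAnd "('x, 'f) expr" "('x, 'f) expr"
  | POr "('x, 'f) expr" "('x, 'f) expr"
  | PImp "('x, 'f) expr" "('x, 'f) expr"
  | PForall 'x "('x, 'f) expr"
  | PExists 'x "('x, 'f) expr"

inductive has_sort :: "('x, 'f, 'k, 'd) language \<Rightarrow> ('x, 'f) expr \<Rightarrow> 'k sort \<Rightarrow> bool" for L where
  "has_sort L (Var x) (var_sort L x)"
| "list_all2 (has_sort L) es (arg_sorts L f) \<Longrightarrow> has_sort L (App f es) (res_sort L f)"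
| "has_sort L e \<tau> \<Longrightarrow> has_sort L e' \<tau> \<Longrightarrow> has_sort L (PEq e e') BoolS"
| "has_sort L PTrue BoolS"
| "has_sort L PFalse BoolS"
| "has_sort L p BoolS \<Longrightarrow> has_sort L (PNot p) BoolS"
| "has_sort L p BoolS \<Longrightarrow> has_sort L q BoolS \<Longrightarrow> has_sort L (PAnd p q) BoolS"
| "has_sort L p BoolS \<Longrightarrow> has_sort L q BoolS \<Longrightarrow> has_sort L (POr p q) BoolS"
| "has_sort L p BoolS \<Longrightarrow> has_sort L q BoolS \<Longrightarrow> has_sort L (PImp p q) BoolS"
| "has_sort L p BoolS \<Longrightarrow> has_sort L (PForall x p) BoolS"
| "has_sort L p BoolS \<Longrightarrow> has_sort L (PExists x p) BoolS"

type_synonym ('x, 'd) stack = "'x \<Rightarrow> 'd val"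

definition is_stack :: "('x, 'f, 'k, 'd) language \<Rightarrow> ('x, 'd) stack \<Rightarrow> bool" where
  "is_stack L s \<longleftrightarrow> (\<forall>x. s x \<in> vals L (var_sort L x))"

fun eval :: "('x, 'f, 'k, 'd) language \<Rightarrow> ('x, 'd) stack \<Rightarrow> ('x, 'f) expr \<Rightarrow> 'd val" where
  "eval L s (Var x) = s x"
| "eval L s (App f es) = interp L f (map (eval L s) es)"
| "eval L s (PEq e e') = BoolV (eval L s e = eval L s e')"
| "eval L s PTrue = BoolV True"
| "eval L s PFalse = BoolV False"
| "eval L s (PNot p) = BoolV (eval L s p \<noteq> BoolV True)"
| "eval L s (PAnd p q) = BoolV (eval L s p = BoolV True \<and> eval L s q = BoolV True)"
| "eval L s (POr p q) = BoolV (eval L s p = BoolV True \<or> eval L s q = BoolV True)"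
| "eval L s (PImp p q) = BoolV (eval L s p = BoolV True \<longrightarrow> eval L s q = BoolV True)"
| "eval L s (PForall x p) =
     BoolV (\<forall>v \<in> vals L (var_sort L x). eval L (s(x := v)) p = BoolV True)"
| "eval L s (PExists x p) =
     BoolV (\<exists>v \<in> vals L (var_sort L x). eval L (s(x := v)) p = BoolV True)"

definition big_and :: "('x, 'f) expr list \<Rightarrow> ('x, 'f) expr" where
  "big_and ps = foldr PAnd ps PTrue"

definition big_or :: "('x, 'f) expr list \<Rightarrow> ('x, 'f) expr" where
  "big_or ps = foldr POr ps PFalse"


section \<open>Heaps and formulas\<close>

type_synonym 'd heap = "int \<rightharpoonup> 'd val"

definition is_heap :: "('x, 'f, 'k, 'd) language \<Rightarrow> 'd heap \<Rightarrow> bool" where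
  "is_heap L h \<longleftrightarrow> ran h \<subseteq> (\<Union>\<tau>. vals L \<tau>)"

definition is_heap_union :: "'d heap \<Rightarrow> 'd heap list \<Rightarrow> bool" where
  "is_heap_union h hs \<longleftrightarrow>
     (\<forall>i j. i < j \<and> j < length hs \<longrightarrow> dom (hs ! i) \<inter> dom (hs ! j) = {}) \<and>
     h = foldr (++) hs Map.empty"

datatype ('x, 'f) spatial =
    Emp
  | Next "('x, 'f) expr" "('x, 'f) expr"
  | Lseg "('x, 'f) expr" "('x, 'f) expr"

fun is_spatial :: "('x, 'f, 'k, 'd) language \<Rightarrow> ('x, 'f) spatial \<Rightarrow> bool" where
  "is_spatial L Emp \<longleftrightarrow> True"
| "is_spatial L (Next x y) \<longleftrightarrow> has_sort L x IntS \<and> has_sort L y IntS"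
| "is_spatial L (Lseg x y) \<longleftrightarrow> has_sort L x IntS \<and> has_sort L y IntS"

type_synonym ('x, 'f) spatial_conj = "('x, 'f) spatial multiset"

definition is_spatial_conj :: "('x, 'f, 'k, 'd) language \<Rightarrow> ('x, 'f) spatial_conj \<Rightarrow> bool" where
  "is_spatial_conj L \<Sigma> \<longleftrightarrow> (\<forall>S \<in># \<Sigma>. is_spatial L S)"

datatype ('x, 'f) formula =
    Pure "('x, 'f) expr"
  | Spatial "('x, 'f) spatial"
  | Star "('x, 'f) formula" "('x, 'f) formula"
  | FNot "('x, 'f) formula"
  | FAnd "('x, 'f) formula" "('x, 'f) formula"
  | FOr "('x, 'f) formula" "('x, 'f) formula"
  | FImp "('x, 'f) formula" "('x, 'f) formula"

fun sat_spatial ::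
  "('x, 'f, 'k, 'd) language \<Rightarrow> ('x, 'd) stack \<Rightarrow> 'd heap \<Rightarrow> ('x, 'f) spatial \<Rightarrow> bool" where
  "sat_spatial L s h Emp \<longleftrightarrow> h = Map.empty"
| "sat_spatial L s h (Next x y) \<longleftrightarrow> h = [the_int (eval L s x) \<mapsto> eval L s y]"
| "sat_spatial L s h (Lseg x z) \<longleftrightarrow>
     (\<exists>n (a :: nat \<Rightarrow> int). IntV (a 0) = eval L s x \<and> IntV (a n) = eval L s z \<and>
        (\<forall>i<n. IntV (a i) \<noteq> eval L s z) \<and>
        is_heap_union h (map (\<lambda>i. [a i \<mapsto> IntV (a (Suc i))]) [0..<n]))"

fun sat ::
  "('x, 'f, 'k, 'd) language \<Rightarrow> ('x, 'd) stack \<Rightarrow> 'd heap \<Rightarrow> ('x, 'f) formula \<Rightarrow> bool" where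
  "sat L s h (Pure p) \<longleftrightarrow> eval L s p = BoolV True"
| "sat L s h (Spatial S) \<longleftrightarrow> sat_spatial L s h S"
| "sat L s h (Star F G) \<longleftrightarrow> (\<exists>h1 h2. is_heap_union h [h1, h2] \<and> sat L s h1 F \<and> sat L s h2 G)"
| "sat L s h (FNot F) \<longleftrightarrow> \<not> sat L s h F"
| "sat L s h (FAnd F G) \<longleftrightarrow> sat L s h F \<and> sat L s h G"
| "sat L s h (FOr F G) \<longleftrightarrow> sat L s h F \<or> sat L s h G"
| "sat L s h (FImp F G) \<longleftrightarrow> (sat L s h F \<longrightarrow> sat L s h G)"

definition models ::
  "('x, 'f, 'k, 'd) language \<Rightarrow> ('x, 'd) stack \<Rightarrow> ('x, 'f) formula \<Rightarrow> bool" where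
  "models L s F \<longleftrightarrow> (\<forall>h. is_heap L h \<longrightarrow> sat L s h F)"

definition valid :: "('x, 'f, 'k, 'd) language \<Rightarrow> ('x, 'f) formula \<Rightarrow> bool" where
  "valid L F \<longleftrightarrow> (\<forall>s h. is_stack L s \<and> is_heap L h \<longrightarrow> sat L s h F)"

text \<open>
  Formulas indexed by the elements of a multiset are built along a fixed but arbitrary
  enumeration. The lemmas \<open>sat_spatial_formula\<close>, \<open>eval_WellFormed\<close> and \<open>eval_Alloc\<close> below show
  that their meaning does not depend on that choice.
\<close>

definition enum :: "'a multiset \<Rightarrow> 'a list" where
  "enum M = (SOME xs. mset xs = M)"

definition star_list :: "('x, 'f) spatial list \<Rightarrow> ('x, 'f) formula" where
  "star_list Ss = foldr Star (map Spatial Ss) (Spatial Emp)"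

definition spatial_formula :: "('x, 'f) spatial_conj \<Rightarrow> ('x, 'f) formula" where
  "spatial_formula \<Sigma> = star_list (enum \<Sigma>)"


section \<open>Auxiliary pure formulas\<close>

fun Empty :: "('x, 'f) spatial \<Rightarrow> ('x, 'f) expr" where
  "Empty Emp = PTrue"
| "Empty (Next x y) = PFalse"
| "Empty (Lseg x y) = PEq x y"

text \<open>
  \<open>Addr Emp\<close> is left unspecified; the definitions below never use it.
\<close>

primrec (nonexhaustive) Addr :: "('x, 'f) spatial \<Rightarrow> ('x, 'f) expr" where
  "Addr (Next x y) = x"
| "Addr (Lseg x y) = x"

definition Collide :: "('x, 'f) spatial \<Rightarrow> ('x, 'f) spatial \<Rightarrow> ('x, 'f) expr" where
  "Collide S S' =
     (if S = Emp \<or> S' = Emp then PFalse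
      else PAnd (PNot (Empty S)) (PAnd (PNot (Empty S')) (PEq (Addr S) (Addr S'))))"

definition WellFormed_list :: "('x, 'f) spatial list \<Rightarrow> ('x, 'f) expr" where
  "WellFormed_list Ss =
     big_and [PNot (Collide (Ss ! i) (Ss ! j)). j \<leftarrow> [0..<length Ss], i \<leftarrow> [0..<j]]"

definition WellFormed :: "('x, 'f) spatial_conj \<Rightarrow> ('x, 'f) expr" where
  "WellFormed \<Sigma> = WellFormed_list (enum \<Sigma>)"

definition Alloc_list :: "('x, 'f) spatial list \<Rightarrow> ('x, 'f) expr \<Rightarrow> ('x, 'f) expr" where
  "Alloc_list Ss x =
     big_or (map (\<lambda>S. if S = Emp then PFalse else PAnd (PNot (Empty S)) (PEq x (Addr S))) Ss)"

definition Alloc :: "('x, 'f) spatial_conj \<Rightarrow> ('x, 'f) expr \<Rightarrow> ('x, 'f) expr" where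
  "Alloc \<Sigma> x = Alloc_list (enum \<Sigma>) x"

text \<open>
  The values of \<open>Update\<close> and \<open>Check\<close> at \<^const>\<open>Emp\<close> are dummies; \<open>Guard\<close> is false there.
\<close>

fun Update :: "('x, 'f) spatial \<Rightarrow> ('x, 'f) spatial \<Rightarrow> ('x, 'f) spatial" where
  "Update (Next x y) (Next x' z) = Emp"
| "Update (Next x y) (Lseg x' z) = Lseg y z"
| "Update (Lseg x y) (Next x' z) = Emp"
| "Update (Lseg x y) (Lseg x' z) = Lseg y z"
| "Update _ _ = Emp"

fun Check ::
  "('x, 'f) spatial_conj \<Rightarrow> ('x, 'f) spatial \<Rightarrow> ('x, 'f) spatial \<Rightarrow> ('x, 'f) expr" where
  "Check \<Sigma>0 (Next x y) (Next x' z) = PEq y z"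
| "Check \<Sigma>0 (Next x y) (Lseg x' z) = PTrue"
| "Check \<Sigma>0 (Lseg x y) (Next x' z) = PFalse"
| "Check \<Sigma>0 (Lseg x y) (Lseg x' z) = PImp (PNot (PEq y z)) (Alloc \<Sigma>0 z)"
| "Check \<Sigma>0 _ _ = PFalse"

definition Guard ::
  "('x, 'f) spatial_conj \<Rightarrow> ('x, 'f) spatial \<Rightarrow> ('x, 'f) spatial \<Rightarrow> ('x, 'f) expr" where
  "Guard \<Sigma>0 S S' =
     (if S = Emp \<or> S' = Emp then PFalse else PAnd (Collide S S') (Check \<Sigma>0 S S'))"


section \<open>The matching procedure\<close>

text \<open>
  \<open>match_call L s \<Sigma>0 (\<Sigma>, \<Sigma>') P (\<Sigma>1, \<Sigma>1')\<close>: for some choice of witnesses, the invocation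
  on \<open>(\<Sigma>, \<Sigma>')\<close> returns the conjunction of \<open>P\<close> and the result of the recursive call on
  \<open>(\<Sigma>1, \<Sigma>1')\<close>.
\<close>

inductive match_call ::
  "('x, 'f, 'k, 'd) language \<Rightarrow> ('x, 'd) stack \<Rightarrow> ('x, 'f) spatial_conj \<Rightarrow>
   ('x, 'f) spatial_conj \<times> ('x, 'f) spatial_conj \<Rightarrow> ('x, 'f) expr \<Rightarrow>
   ('x, 'f) spatial_conj \<times> ('x, 'f) spatial_conj \<Rightarrow> bool"
  for L s \<Sigma>0 where
  empty_left:
    "\<lbrakk> S \<in># \<Sigma>; models L s (Pure (Empty S)) \<rbrakk>
     \<Longrightarrow> match_call L s \<Sigma>0 (\<Sigma>, \<Sigma>') (Empty S) (\<Sigma> - {#S#}, \<Sigma>')"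
| empty_right:
    "\<lbrakk> \<not> (\<exists>S \<in># \<Sigma>. models L s (Pure (Empty S)));
       S' \<in># \<Sigma>'; models L s (Pure (Empty S')) \<rbrakk>
     \<Longrightarrow> match_call L s \<Sigma>0 (\<Sigma>, \<Sigma>') (Empty S') (\<Sigma>, \<Sigma>' - {#S'#})"
| guard:
    "\<lbrakk> \<not> (\<exists>S \<in># \<Sigma>. models L s (Pure (Empty S)));
       \<not> (\<exists>S' \<in># \<Sigma>'. models L s (Pure (Empty S')));
       S \<in># \<Sigma>; S' \<in># \<Sigma>'; models L s (Pure (Guard \<Sigma>0 S S')) \<rbrakk>
     \<Longrightarrow> match_call L s \<Sigma>0 (\<Sigma>, \<Sigma>') (Guard \<Sigma>0 S S')
           (\<Sigma> - {#S#}, (\<Sigma>' - {#S'#}) + {#Update S S'#})"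

text \<open>
  \<open>match L s \<Sigma>0 \<Sigma> \<Sigma>' k U\<close>: some execution on \<open>(s, \<Sigma>0, \<Sigma>, \<Sigma>')\<close> terminates after \<open>k\<close>
  recursive calls with result \<open>U\<close>.
\<close>

inductive match ::
  "('x, 'f, 'k, 'd) language \<Rightarrow> ('x, 'd) stack \<Rightarrow> ('x, 'f) spatial_conj \<Rightarrow>
   ('x, 'f) spatial_conj \<Rightarrow> ('x, 'f) spatial_conj \<Rightarrow> nat \<Rightarrow> ('x, 'f) expr \<Rightarrow> bool"
  for L s \<Sigma>0 where
  return:
    "\<lbrakk> \<not> (\<exists>S \<in># \<Sigma>. models L s (Pure (Empty S)));
       \<not> (\<exists>S' \<in># \<Sigma>'. models L s (Pure (Empty S')));
       \<not> (\<exists>S \<in># \<Sigma>. \<exists>S' \<in># \<Sigma>'. models L s (Pure (Guard \<Sigma>0 S S'))) \<rbrakk>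
     \<Longrightarrow> match L s \<Sigma>0 \<Sigma> \<Sigma>' 0 (if \<Sigma> = {#} \<and> \<Sigma>' = {#} then PTrue else PFalse)"
| recurse:
    "\<lbrakk> match_call L s \<Sigma>0 (\<Sigma>, \<Sigma>') P (\<Sigma>1, \<Sigma>1'); match L s \<Sigma>0 \<Sigma>1 \<Sigma>1' k U \<rbrakk>
     \<Longrightarrow> match L s \<Sigma>0 \<Sigma> \<Sigma>' (Suc k) (PAnd P U)"

text \<open>
  The relation \<^const>\<open>match\<close> only sees finite executions, so termination for all choices is the
  absence of an infinite chain of recursive calls.
\<close>

definition match_terminates ::
  "('x, 'f, 'k, 'd) language \<Rightarrow> ('x, 'd) stack \<Rightarrow> ('x, 'f) spatial_conj \<Rightarrow>
   ('x, 'f) spatial_conj \<Rightarrow> ('x, 'f) spatial_conj \<Rightarrow> bool" where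
  "match_terminates L s \<Sigma>0 \<Sigma> \<Sigma>' \<longleftrightarrow>
     \<not> (\<exists>c. c 0 = (\<Sigma>, \<Sigma>') \<and> (\<forall>i. \<exists>P. match_call L s \<Sigma>0 (c i) P (c (Suc i))))"


section \<open>Independence of the enumeration\<close>

lemma mset_enum [simp]: "mset (enum M) = M"
  unfolding enum_def by (rule someI_ex) (rule ex_mset)

lemma eval_big_and: "eval L s (big_and ps) = BoolV (\<forall>p \<in> set ps. eval L s p = BoolV True)"
  unfolding big_and_def by (induction ps) auto

lemma eval_big_or: "eval L s (big_or ps) = BoolV (\<exists>p \<in> set ps. eval L s p = BoolV True)"
  unfolding big_or_def by (induction ps) auto

lemma eval_Alloc: "eval L s (Alloc (mset Ss) x) = eval L s (Alloc_list Ss x)"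
proof -
  have "set (enum (mset Ss)) = set Ss"
    by (metis mset_enum set_mset_mset)
  then show ?thesis
    by (simp add: Alloc_def Alloc_list_def eval_big_or)
qed

lemma Collide_sym: "eval L s (Collide S S') = eval L s (Collide S' S)"
  by (auto simp: Collide_def)

lemma eval_WellFormed_list:
  "eval L s (WellFormed_list Ss) =
     BoolV (\<forall>j<length Ss. \<forall>i<j. eval L s (Collide (Ss ! i) (Ss ! j)) \<noteq> BoolV True)"
  by (auto simp: WellFormed_list_def eval_big_and)

lemma eval_WellFormed: "eval L s (WellFormed (mset Ss)) = eval L s (WellFormed_list Ss)"
proof -
  define R where "R S S' \<longleftrightarrow> eval L s (Collide S S') \<noteq> BoolV True" for S S'
  have R_sym: "R S S' \<Longrightarrow> R S' S" for S S'
    by (simp add: R_def Collide_sym)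
  have list: "eval L s (WellFormed_list Ts) = BoolV (sorted_wrt R Ts)" for Ts
    by (auto simp: eval_WellFormed_list sorted_wrt_iff_nth_less R_def)
  have perm: "sorted_wrt R Us" if "mset Ts = mset Us" "sorted_wrt R Ts" for Ts Us
    using that
  proof (induction Ts arbitrary: Us)
    case Nil
    then show ?case by simp
  next
    case (Cons T Ts)
    then have "T \<in> set Us"
      by (metis list.set_intros(1) set_mset_mset)
    then obtain As Bs where Us: "Us = As @ T # Bs"
      by (meson split_list)
    have eq: "mset Ts = mset (As @ Bs)"
      using Cons.prems(1) Us by simp
    have "sorted_wrt R (As @ Bs)"
      using Cons eq by simp
    moreover have "\<forall>S \<in> set As \<union> set Bs. R T S"
      using Cons.prems(2) arg_cong[OF eq, of set_mset] by auto
    ultimately show ?case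
      using R_sym by (auto simp: Us sorted_wrt_append)
  qed
  show ?thesis
    unfolding WellFormed_def list
    using perm[of Ss "enum (mset Ss)"] perm[of "enum (mset Ss)" Ss] by auto
qed

lemma heap_union_pair:
  "is_heap_union h [h1, h2] \<longleftrightarrow> dom h1 \<inter> dom h2 = {} \<and> h = h1 ++ h2"
  by (auto simp: is_heap_union_def less_Suc_eq nth_Cons split: nat.splits)

lemma sat_star_comm: "sat L s h (Star F (Star G H)) \<Longrightarrow> sat L s h (Star G (Star F H))"
  unfolding sat.simps heap_union_pair
proof (elim exE conjE)
  fix h1 h2 h3 h4
  assume *: "dom h1 \<inter> dom h2 = {}" "h = h1 ++ h2" "sat L s h1 F"
    "dom h3 \<inter> dom h4 = {}" "h2 = h3 ++ h4" "sat L s h3 G" "sat L s h4 H"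
  have "h = h3 ++ (h1 ++ h4)"
    using * by (metis Int_Un_distrib Un_empty dom_map_add map_add_assoc map_add_comm)
  then show "\<exists>h1 h2. (dom h1 \<inter> dom h2 = {} \<and> h = h1 ++ h2) \<and> sat L s h1 G \<and>
      (\<exists>h1' h2'. (dom h1' \<inter> dom h2' = {} \<and> h2 = h1' ++ h2') \<and> sat L s h1' F \<and> sat L s h2' H)"
    using * by (intro exI[of _ h3] exI[of _ "h1 ++ h4"] conjI exI[of _ h1] exI[of _ h4]) auto
qed

lemma sat_star_mono:
  "(\<And>h. sat L s h G \<Longrightarrow> sat L s h H) \<Longrightarrow> sat L s h (Star F G) \<Longrightarrow> sat L s h (Star F H)"
  unfolding sat.simps by blast

lemma sat_star_list_move:
  "sat L s h (Star (Spatial S) (star_list (As @ Bs))) \<Longrightarrow> sat L s h (star_list (As @ S # Bs))"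
proof (induction As arbitrary: h)
  case Nil
  then show ?case by (simp add: star_list_def)
next
  case (Cons A As)
  have "sat L s h (Star (Spatial A) (Star (Spatial S) (star_list (As @ Bs))))"
    using Cons.prems sat_star_comm by (simp add: star_list_def del: sat.simps) blast
  then have "sat L s h (Star (Spatial A) (star_list (As @ S # Bs)))"
    using Cons.IH sat_star_mono by blast
  then show ?case by (simp add: star_list_def)
qed

lemma sat_star_list_perm:
  "mset Ss = mset Ts \<Longrightarrow> sat L s h (star_list Ss) \<Longrightarrow> sat L s h (star_list Ts)"
proof (induction Ss arbitrary: Ts h)
  case Nil
  then show ?case by simp
next
  case (Cons S Ss)
  then have "S \<in> set Ts"
    by (metis list.set_intros(1) set_mset_mset)
  then obtain As Bs where Ts: "Ts = As @ S # Bs"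
    by (meson split_list)
  have "sat L s h (Star (Spatial S) (star_list Ss))"
    using Cons.prems(2) by (simp add: star_list_def)
  moreover have "mset Ss = mset (As @ Bs)"
    using Cons.prems(1) Ts by simp
  ultimately have "sat L s h (Star (Spatial S) (star_list (As @ Bs)))"
    using Cons.IH sat_star_mono by blast
  then show ?case
    unfolding Ts by (rule sat_star_list_move)
qed

lemma sat_spatial_formula:
  "sat L s h (spatial_formula (mset Ss)) \<longleftrightarrow> sat L s h (star_list Ss)"
  unfolding spatial_formula_def
  using sat_star_list_perm[of Ss "enum (mset Ss)"] sat_star_list_perm[of "enum (mset Ss)" Ss]
  by (simp only: mset_enum) blast

end

theory Submission
  imports Defs
begin

text \<open>
  Each recursive call decreases \<open>size \<Sigma> + size \<Sigma>'\<close>, which bounds the number of calls.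
  Let \<open>R\<close> collect the predicates already removed from \<open>\<Sigma>\<close>. Both correctness directions
  are inductions over the execution which keep the heap of the remaining predicates disjoint
  from the addresses of the nonempty predicates in \<open>R\<close>. For soundness, this lets two
  list segments be concatenated: the allocated end point required by \<open>Check\<close> lies outside the
  first segment.

  For completeness, a counterexample to the final state is extended by one single cell per matched
  predicate. In the final state, start from the heap with one cell for each predicate of \<open>\<Sigma>\<close>. If it
  satisfies \<open>\<Sigma>'\<close>, then some \<open>S'\<close> in \<open>\<Sigma>'\<close> starts at the address of some \<open>S = lseg(x, y)\<close> in \<open>\<Sigma>\<close>
  with a failing check, and replacing the cell from \<open>x\<close> to \<open>y\<close> by a detour through a suitable
  unallocated address refutes \<open>\<Sigma>'\<close>.
\<close>

section \<open>Heaps\<close>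

lemma dom_heap_union: "dom (foldr (++) hs Map.empty) = (\<Union>h \<in> set hs. dom h)"
  by (induction hs) auto

lemma is_heap_union_Nil: "is_heap_union h [] \<longleftrightarrow> h = Map.empty"
  by (simp add: is_heap_union_def)

text \<open>Turns the index-based disjointness of \<open>is_heap_union\<close> into a recursion on
  the list. The head is disjoint from every later heap exactly when it is disjoint from their
  union.\<close>

lemma is_heap_union_Cons:
  "is_heap_union h (g # gs) \<longleftrightarrow>
     (\<exists>h'. dom g \<inter> dom h' = {} \<and> h = g ++ h' \<and> is_heap_union h' gs)" (is "?l \<longleftrightarrow> ?r")
proof
  assume l: ?l
  have "is_heap_union (foldr (++) gs Map.empty) gs"
    using l unfolding is_heap_union_def
    by (metis Suc_less_eq length_Cons nth_Cons_Suc)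
  moreover have "dom g \<inter> dom (foldr (++) gs Map.empty) = {}"
  proof -
    have "dom g \<inter> dom (gs ! j) = {}" if "j < length gs" for j
      using l that unfolding is_heap_union_def
      by (metis Suc_less_eq length_Cons nth_Cons_0 nth_Cons_Suc zero_less_Suc)
    then show ?thesis
      unfolding dom_heap_union by (fastforce simp: in_set_conv_nth)
  qed
  ultimately show ?r
    using l by (auto simp: is_heap_union_def)
next
  assume ?r
  then have h: "h = foldr (++) (g # gs) Map.empty"
    and g: "dom g \<inter> dom (foldr (++) gs Map.empty) = {}"
    and gs: "\<forall>i j. i < j \<and> j < length gs \<longrightarrow> dom (gs ! i) \<inter> dom (gs ! j) = {}"
    by (auto simp: is_heap_union_def)
  have "dom ((g # gs) ! i) \<inter> dom ((g # gs) ! j) = {}" if ij: "i < j" "j < length (g # gs)" for i j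
  proof (cases i)
    case 0
    then obtain j' where j: "j = Suc j'"
      using ij(1) by (cases j) auto
    then have "gs ! j' \<in> set gs"
      using ij(2) j by simp
    then have "dom g \<inter> dom (gs ! j') = {}"
      using g unfolding dom_heap_union by blast
    then show ?thesis
      using 0 j by simp
  next
    case (Suc i')
    then show ?thesis
      using that gs by (cases j) auto
  qed
  then show ?l
    using h by (auto simp: is_heap_union_def)
qed

lemma is_heap_union_cell_Cons:
  "is_heap_union h ([a \<mapsto> v] # gs) \<longleftrightarrow>
     (\<exists>h'. a \<notin> dom h' \<and> h = [a \<mapsto> v] ++ h' \<and> is_heap_union h' gs)"
  by (simp add: is_heap_union_Cons)

lemma cell_add: "a \<notin> dom h \<Longrightarrow> [a \<mapsto> v] ++ h = h(a \<mapsto> v)"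
  by (auto simp: map_add_def fun_eq_iff split: option.splits)

text \<open>Looking up \<open>a\<close> compares the contents; elsewhere the remainders agree, and
  at \<open>a\<close> both are undefined.\<close>

lemma cell_add_eqD:
  assumes "[a \<mapsto> v] ++ h = [a \<mapsto> v'] ++ h'" "a \<notin> dom h" "a \<notin> dom h'"
  shows "v = v' \<and> h = h'"
proof -
  have eq: "h(a \<mapsto> v) = h'(a \<mapsto> v')"
    using assms by (simp add: cell_add)
  then have "v = v'"
    by (metis fun_upd_same option.inject)
  moreover have "h = h'"
    using eq assms(2,3) by (metis domIff fun_upd_triv fun_upd_upd)
  ultimately show ?thesis ..
qed

section \<open>List segments as an inductive predicate\<close>

text \<open>Peels \<open>lseg\<close> off cell by cell. The premise \<open>a \<noteq> b\<close> of
  \<open>cons\<close> encodes that a path reaches its end value only once.\<close>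

inductive list_segment :: "int \<Rightarrow> int \<Rightarrow> 'd heap \<Rightarrow> bool" where
  nil: "list_segment b b Map.empty"
| cons: "\<lbrakk> a \<noteq> b; a \<notin> dom h; list_segment c b h \<rbrakk>
         \<Longrightarrow> list_segment a b ([a \<mapsto> IntV c] ++ h)"

lemma list_segment_refl_iff: "list_segment b b h \<longleftrightarrow> h = Map.empty"
proof
  show "list_segment b b h \<Longrightarrow> h = Map.empty"
    by (cases rule: list_segment.cases) auto
qed (simp add: list_segment.nil)

lemma list_segmentE:
  assumes "list_segment a b h" "a \<noteq> b"
  obtains c h' where "h = [a \<mapsto> IntV c] ++ h'" "a \<notin> dom h'" "list_segment c b h'"
  using assms(1)
proof cases
  case nil
  then show ?thesis using assms(2) by simp
next
  case (cons h' c)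
  then show ?thesis using that by simp
qed

lemma list_segment_dom: "list_segment a b h \<Longrightarrow> a \<noteq> b \<Longrightarrow> a \<in> dom h"
  by (cases rule: list_segment.cases) auto

text \<open>Every allocated address is the source of some \<open>cons\<close> step and so differs
  from \<open>b\<close>.\<close>

lemma list_segment_end: "list_segment a b h \<Longrightarrow> b \<notin> dom h"
  by (induction rule: list_segment.induct) auto

lemma list_segment_cell: "a \<noteq> b \<Longrightarrow> list_segment a b [a \<mapsto> IntV b]"
  using list_segment.cons[of a b Map.empty b] by (simp add: list_segment.nil)

text \<open>The premise \<open>c \<notin> dom h\<close> keeps the joined path from meeting
  \<open>c\<close> too early: each source in the first segment differs from \<open>c\<close>, so
  \<open>cons\<close> still applies.\<close>

lemma list_segment_append:
  "\<lbrakk> list_segment a b h; list_segment b c g; dom h \<inter> dom g = {}; c \<notin> dom h \<rbrakk>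
   \<Longrightarrow> list_segment a c (h ++ g)"
proof (induction rule: list_segment.induct)
  case nil
  then show ?case by simp
next
  case (cons a b h d)
  then have "list_segment d c (h ++ g)" "a \<noteq> c" "a \<notin> dom (h ++ g)"
    by auto
  then show ?case
    by (metis list_segment.cons map_add_assoc)
qed

text \<open>Both segments read each successor from the same heap \<open>h\<close>, so they follow
  the same cells until they reach \<open>b\<close>.\<close>

lemma list_segment_precise:
  "\<lbrakk> list_segment a b h1; list_segment a b h2; h1 \<subseteq>\<^sub>m h; h2 \<subseteq>\<^sub>m h \<rbrakk> \<Longrightarrow> h1 = h2"
proof (induction arbitrary: h2 rule: list_segment.induct)
  case nil
  then show ?case by (simp add: list_segment_refl_iff)
next
  case (cons a b h1 c)
  obtain d g where g: "h2 = [a \<mapsto> IntV d] ++ g" "a \<notin> dom g" "list_segment d b g"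
    using cons.prems(1) cons.hyps(1) by (rule list_segmentE)
  have "([a \<mapsto> IntV c] ++ h1) a = Some (IntV c)" "h2 a = Some (IntV d)"
    using cons.hyps(2) g(1,2) by (simp_all add: cell_add)
  then have "Some (IntV c) = h a" "Some (IntV d) = h a"
    using cons.prems(2,3) by (metis domI map_le_def)+
  then have "c = d"
    by (metis option.inject val.inject(1))
  moreover have "h1 \<subseteq>\<^sub>m h" "g \<subseteq>\<^sub>m h"
    using cons.prems(2,3) g(1) map_add_le_mapE by blast+
  ultimately show ?case
    using cons.IH g by simp
qed

lemma upt_Suc_conv_map: "[0..<Suc n] = 0 # map Suc [0..<n]"
  by (simp add: map_Suc_upt upt_conv_Cons del: upt_Suc)

lemma list_segment_of_path:
  fixes a :: "nat \<Rightarrow> int"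
  assumes "\<forall>i<n. a i \<noteq> a n"
    and "is_heap_union h (map (\<lambda>i. [a i \<mapsto> IntV (a (Suc i))]) [0..<n])"
  shows "list_segment (a 0) (a n) h"
  using assms
proof (induction n arbitrary: a h)
  case 0
  then show ?case by (simp add: is_heap_union_Nil list_segment.nil)
next
  case (Suc n)
  have "is_heap_union h ([a 0 \<mapsto> IntV (a (Suc 0))] #
      map (\<lambda>i. [a (Suc i) \<mapsto> IntV (a (Suc (Suc i)))]) [0..<n])"
    using Suc.prems(2) unfolding upt_Suc_conv_map list.map map_map comp_def .
  then obtain h' where h': "a 0 \<notin> dom h'"
    "h = [a 0 \<mapsto> IntV (a (Suc 0))] ++ h'"
    "is_heap_union h' (map (\<lambda>i. [a (Suc i) \<mapsto> IntV (a (Suc (Suc i)))]) [0..<n])"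
    unfolding is_heap_union_cell_Cons by blast
  have "a 0 \<noteq> a (Suc n)"
    using Suc.prems(1) by simp
  moreover note h'(1)
  moreover have "\<forall>i<n. a (Suc i) \<noteq> a (Suc n)"
    using Suc.prems(1) by simp
  then have "list_segment (a (Suc 0)) (a (Suc n)) h'"
    using h'(3) by (rule Suc.IH)
  ultimately show ?case
    unfolding h'(2) by (rule list_segment.cons)
qed

lemma path_of_list_segment:
  assumes "list_segment p q h"
  obtains n and a :: "nat \<Rightarrow> int" where "a 0 = p" "a n = q" "\<forall>i<n. a i \<noteq> q"
    "is_heap_union h (map (\<lambda>i. [a i \<mapsto> IntV (a (Suc i))]) [0..<n])"
proof -
  have "\<exists>n (a :: nat \<Rightarrow> int). a 0 = p \<and> a n = q \<and> (\<forall>i<n. a i \<noteq> q) \<and>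
      is_heap_union h (map (\<lambda>i. [a i \<mapsto> IntV (a (Suc i))]) [0..<n])"
    using assms
  proof (induction rule: list_segment.induct)
    case (nil b)
    show ?case
      by (intro exI[of _ 0] exI[of _ "\<lambda>_. b"]) (simp add: is_heap_union_Nil)
  next
    case (cons a q h c)
    from cons.IH obtain n b where b: "b 0 = c" "b n = q" "\<forall>i<n. b i \<noteq> q"
      "is_heap_union h (map (\<lambda>i. [b i \<mapsto> IntV (b (Suc i))]) [0..<n])"
      by blast
    \<comment> \<open>Prepends \<open>a\<close> to the path \<open>b\<close>, shifting its indices
      by one.\<close>
    define b' where "b' = case_nat a b"
    have b': "b' 0 = a" "b' (Suc i) = b i" for i
      by (simp_all add: b'_def)
    have "is_heap_union ([a \<mapsto> IntV c] ++ h)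
        (map (\<lambda>i. [b' i \<mapsto> IntV (b' (Suc i))]) [0..<Suc n])"
      unfolding upt_Suc_conv_map list.map map_map comp_def b' is_heap_union_cell_Cons b(1)
      using b(4) cons.hyps(2) by (intro exI[of _ h]) simp
    moreover have "\<forall>i<Suc n. b' i \<noteq> q"
      using b(3) cons.hyps(1) b' by (simp add: All_less_Suc2)
    moreover have "b' (Suc n) = q"
      using b(2) b' by simp
    ultimately show ?case
      using b'(1) by (intro exI[of _ "Suc n"] exI[of _ b'] conjI)
  qed
  then show thesis
    using that by blast
qed

text \<open>Links the inductive predicate to the path semantics in the \<open>Lseg\<close> clause of
  \<open>sat_spatial\<close>.\<close>

lemma list_segment_iff_path:
  "list_segment p q h \<longleftrightarrow>
     (\<exists>n (a :: nat \<Rightarrow> int). a 0 = p \<and> a n = q \<and> (\<forall>i<n. a i \<noteq> q) \<and>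
        is_heap_union h (map (\<lambda>i. [a i \<mapsto> IntV (a (Suc i))]) [0..<n]))" (is "_ \<longleftrightarrow> ?r")
proof
  assume "list_segment p q h"
  then obtain n and a :: "nat \<Rightarrow> int" where "a 0 = p" "a n = q" "\<forall>i<n. a i \<noteq> q"
    "is_heap_union h (map (\<lambda>i. [a i \<mapsto> IntV (a (Suc i))]) [0..<n])"
    by (rule path_of_list_segment)
  then show ?r
    by (intro exI[of _ n] exI[of _ a] conjI)
next
  assume ?r
  then obtain n and a :: "nat \<Rightarrow> int" where "a 0 = p" "a n = q" "\<forall>i<n. a i \<noteq> q"
    "is_heap_union h (map (\<lambda>i. [a i \<mapsto> IntV (a (Suc i))]) [0..<n])"
    by blast
  then show "list_segment p q h"
    using list_segment_of_path[of n a h] by simp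
qed


section \<open>Spatial conjunctions over a fixed stack\<close>

lemma sat_spatial_formula_empty [simp]:
  "sat L s h (spatial_formula {#}) \<longleftrightarrow> h = Map.empty"
  using sat_spatial_formula[of L s h "[]"] by (simp add: star_list_def)

lemma sat_spatial_formula_add_mset:
  "sat L s h (spatial_formula (add_mset S \<Sigma>)) \<longleftrightarrow>
     (\<exists>h1 h2. dom h1 \<inter> dom h2 = {} \<and> h = h1 ++ h2 \<and> sat_spatial L s h1 S \<and>
        sat L s h2 (spatial_formula \<Sigma>))"
proof -
  obtain Ss where Ss: "\<Sigma> = mset Ss"
    by (metis ex_mset)
  have "sat L s h (spatial_formula (mset (S # Ss))) \<longleftrightarrow>
      sat L s h (Star (Spatial S) (star_list Ss))"
    unfolding sat_spatial_formula by (simp add: star_list_def)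
  then show ?thesis
    by (auto simp: Ss heap_union_pair sat_spatial_formula)
qed

text \<open>A pure formula ignores the heap, and the empty heap shows that the quantifier in
  \<open>models\<close> is not vacuous.\<close>

lemma models_Pure: "models L s (Pure p) \<longleftrightarrow> eval L s p = BoolV True"
proof -
  have "is_heap L Map.empty"
    by (simp add: is_heap_def)
  then show ?thesis
    by (auto simp: models_def)
qed

text \<open>Its instance at \<open>IntS\<close> shows that \<open>the_int\<close> loses nothing on
  the arguments of spatial predicates.\<close>

lemma eval_in_vals:
  assumes "has_sort L e \<tau>" "is_language L" "is_stack L s"
  shows "eval L s e \<in> vals L \<tau>"
  using assms(1)
proof (induction rule: has_sort.induct)
  case (1 x)
  then show ?case using assms(3) by (simp add: is_stack_def)
next
  case (2 es f)
  then have "list_all2 (\<lambda>v \<tau>. v \<in> vals L \<tau>) (map (eval L s) es) (arg_sorts L f)"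
    by (auto simp: list_all2_conv_all_nth)
  then show ?case using assms(2) by (simp add: is_language_def)
qed auto

text \<open>The content of the single cell with which \<open>sat_cell\<close> satisfies a nonempty
  predicate; the value at \<open>Emp\<close> is a dummy.\<close>

fun target :: "('x, 'f) spatial \<Rightarrow> ('x, 'f) expr" where
  "target Emp = undefined"
| "target (Next x y) = y"
| "target (Lseg x y) = y"

locale language_stack =
  fixes L :: "('x, 'f, 'k, 'd) language" and s :: "('x, 'd) stack"
  assumes language: "is_language L" and stack: "is_stack L s"
begin

abbreviation int_of :: "('x, 'f) expr \<Rightarrow> int" where
  "int_of e \<equiv> the_int (eval L s e)"

abbreviation nonempty :: "('x, 'f) spatial \<Rightarrow> bool" where
  "nonempty S \<equiv> eval L s (Empty S) \<noteq> BoolV True"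

abbreviation holds :: "'d heap \<Rightarrow> ('x, 'f) spatial_conj \<Rightarrow> bool" where
  "holds h \<Sigma> \<equiv> sat L s h (spatial_formula \<Sigma>)"

text \<open>The set-level counterpart of \<open>Alloc\<close>: the addresses that every model of
  \<open>\<Sigma>\<close> must allocate, see \<open>holds_addrs\<close>.\<close>

definition addrs :: "('x, 'f) spatial_conj \<Rightarrow> int set" where
  "addrs \<Sigma> = {int_of (Addr S) | S. S \<in># \<Sigma> \<and> nonempty S}"

text \<open>The semantic form of \<open>WellFormed\<close>. Splitting off one occurrence respects
  multiplicities, so two copies of a nonempty predicate violate it.\<close>

definition separated :: "('x, 'f) spatial_conj \<Rightarrow> bool" where
  "separated \<Sigma> \<longleftrightarrow>
     (\<forall>S \<Sigma>1. \<Sigma> = add_mset S \<Sigma>1 \<and> nonempty S \<longrightarrow> int_of (Addr S) \<notin> addrs \<Sigma>1)"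

lemma addrs_empty [simp]: "addrs {#} = {}"
  by (simp add: addrs_def)

lemma addrs_add_mset:
  "addrs (add_mset S \<Sigma>) = (if nonempty S then {int_of (Addr S)} else {}) \<union> addrs \<Sigma>"
  by (auto simp: addrs_def)

lemma addrs_union: "addrs (\<Sigma> + \<Sigma>') = addrs \<Sigma> \<union> addrs \<Sigma>'"
  by (auto simp: addrs_def)

lemma finite_addrs: "finite (addrs \<Sigma>)"
  by (induction \<Sigma>) (auto simp: addrs_add_mset)

lemma eval_int: "has_sort L e IntS \<Longrightarrow> eval L s e = IntV (int_of e)"
  using eval_in_vals[OF _ language stack, of e IntS] by auto

lemma eval_eq_iff:
  "has_sort L e IntS \<Longrightarrow> has_sort L e' IntS \<Longrightarrow> eval L s e = eval L s e' \<longleftrightarrow> int_of e = int_of e'"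
  using eval_int by metis

lemma sat_Next:
  "is_spatial L (Next x y) \<Longrightarrow> sat_spatial L s h (Next x y) \<longleftrightarrow> h = [int_of x \<mapsto> IntV (int_of y)]"
  using eval_int by simp

lemma sat_Lseg:
  assumes "is_spatial L (Lseg x y)"
  shows "sat_spatial L s h (Lseg x y) \<longleftrightarrow> list_segment (int_of x) (int_of y) h"
proof -
  have "eval L s x = IntV (int_of x)" "eval L s y = IntV (int_of y)"
    using assms eval_int by auto
  then obtain a b where "eval L s x = IntV a" "eval L s y = IntV b"
    by blast
  then show ?thesis
    by (simp add: list_segment_iff_path)
qed

lemma sat_empty:
  assumes "is_spatial L S" "\<not> nonempty S"
  shows "sat_spatial L s h S \<longleftrightarrow> h = Map.empty"
proof (cases S)
  case (Lseg x y)
  then have "int_of x = int_of y"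
    using assms(2) by simp
  then show ?thesis
    using assms(1) unfolding Lseg by (simp only: sat_Lseg list_segment_refl_iff)
qed (use assms in auto)

lemma nonempty_Lseg:
  "is_spatial L (Lseg x y) \<Longrightarrow> nonempty (Lseg x y) \<longleftrightarrow> int_of x \<noteq> int_of y"
  using eval_eq_iff by simp

lemma sat_nonempty_dom:
  assumes "is_spatial L S" "nonempty S" "sat_spatial L s h S"
  shows "int_of (Addr S) \<in> dom h"
proof (cases S)
  case (Lseg x y)
  then have "list_segment (int_of x) (int_of y) h" "int_of x \<noteq> int_of y"
    using assms nonempty_Lseg sat_Lseg by blast+
  then show ?thesis
    using Lseg list_segment_dom by simp
qed (use assms in auto)

text \<open>A nonempty \<open>lseg\<close> has distinct ends, so a segment of length one satisfies
  it.\<close>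

lemma sat_cell:
  assumes "is_spatial L S" "nonempty S"
  shows "sat_spatial L s [int_of (Addr S) \<mapsto> IntV (int_of (target S))] S"
proof (cases S)
  case (Next x y)
  then show ?thesis using assms sat_Next[of x y] by simp
next
  case (Lseg x y)
  then have "int_of x \<noteq> int_of y"
    using assms nonempty_Lseg by blast
  then show ?thesis
    using assms(1) sat_Lseg list_segment_cell unfolding Lseg Addr.simps target.simps by blast
qed (use assms in auto)

lemma sat_spatial_precise:
  assumes "is_spatial L S" "sat_spatial L s h1 S" "sat_spatial L s h2 S" "h1 \<subseteq>\<^sub>m h" "h2 \<subseteq>\<^sub>m h"
  shows "h1 = h2"
proof (cases S)
  case (Lseg x y)
  then have "list_segment (int_of x) (int_of y) h1" "list_segment (int_of x) (int_of y) h2"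
    using assms(1-3) sat_Lseg by blast+
  then show ?thesis
    using assms(4,5) by (rule list_segment_precise)
qed (use assms in auto)

lemma is_spatial_conj_simps [simp]:
  "is_spatial_conj L {#}"
  "is_spatial_conj L (add_mset S \<Sigma>) \<longleftrightarrow> is_spatial L S \<and> is_spatial_conj L \<Sigma>"
  "is_spatial_conj L (\<Sigma> + \<Sigma>') \<longleftrightarrow> is_spatial_conj L \<Sigma> \<and> is_spatial_conj L \<Sigma>'"
  by (auto simp: is_spatial_conj_def)

text \<open>Within a common heap each predicate determines its own part, hence so does their
  union.\<close>

lemma holds_precise:
  "\<lbrakk> is_spatial_conj L \<Sigma>; holds h1 \<Sigma>; holds h2 \<Sigma>; h1 \<subseteq>\<^sub>m h; h2 \<subseteq>\<^sub>m h \<rbrakk> \<Longrightarrow> h1 = h2"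
proof (induction \<Sigma> arbitrary: h1 h2)
  case empty
  then show ?case by simp
next
  case (add S \<Sigma>)
  obtain a1 b1 where 1: "dom a1 \<inter> dom b1 = {}" "h1 = a1 ++ b1" "sat_spatial L s a1 S" "holds b1 \<Sigma>"
    using add.prems(2) unfolding sat_spatial_formula_add_mset by blast
  obtain a2 b2 where 2: "dom a2 \<inter> dom b2 = {}" "h2 = a2 ++ b2" "sat_spatial L s a2 S" "holds b2 \<Sigma>"
    using add.prems(3) unfolding sat_spatial_formula_add_mset by blast
  \<comment> \<open>Since \<open>++\<close> prefers its right argument, commuting the disjoint
    summands is what makes the left ones submaps.\<close>
  have "a1 \<subseteq>\<^sub>m h" "b1 \<subseteq>\<^sub>m h" "a2 \<subseteq>\<^sub>m h" "b2 \<subseteq>\<^sub>m h"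
    using add.prems(4,5) 1(1,2) 2(1,2) map_add_comm[of a1 b1] map_add_comm[of a2 b2]
      map_add_le_mapE[of a1 b1 h] map_add_le_mapE[of a2 b2 h]
      map_add_le_mapE[of b1 a1 h] map_add_le_mapE[of b2 a2 h] by simp_all
  then have "a1 = a2" "b1 = b2"
    using add.IH[OF _ 1(4) 2(4)] sat_spatial_precise[OF _ 1(3) 2(3)] add.prems(1) by simp_all
  then show ?case using 1 2 by simp
qed

lemma holds_addrs: "is_spatial_conj L \<Sigma> \<Longrightarrow> holds h \<Sigma> \<Longrightarrow> addrs \<Sigma> \<subseteq> dom h"
proof (induction \<Sigma> arbitrary: h)
  case empty
  then show ?case by simp
next
  case (add S \<Sigma>)
  obtain h1 h2 where h: "h = h1 ++ h2" "sat_spatial L s h1 S" "holds h2 \<Sigma>"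
    using add.prems(2) unfolding sat_spatial_formula_add_mset by blast
  have "addrs \<Sigma> \<subseteq> dom h2"
    using add.IH[of h2] add.prems(1) h(3) by simp
  moreover have "nonempty S \<Longrightarrow> int_of (Addr S) \<in> dom h1"
    using sat_nonempty_dom[of S h1] add.prems(1) h(2) by simp
  ultimately show ?case
    unfolding h(1) addrs_add_mset dom_map_add by (cases "nonempty S") auto
qed

lemma holds_add_empty:
  assumes "is_spatial L S" "\<not> nonempty S"
  shows "holds h (add_mset S \<Sigma>) \<longleftrightarrow> holds h \<Sigma>"
  unfolding sat_spatial_formula_add_mset sat_empty[OF assms] by simp

section \<open>Meaning of the pure side conditions\<close>

lemma nonempty_not_Emp: "nonempty S \<Longrightarrow> S \<noteq> Emp"
  by auto

lemma has_sort_Addr: "is_spatial L S \<Longrightarrow> S \<noteq> Emp \<Longrightarrow> has_sort L (Addr S) IntS"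
  by (cases S) auto

lemma eval_Collide:
  assumes "is_spatial L S" "is_spatial L S'"
  shows "eval L s (Collide S S') = BoolV True \<longleftrightarrow>
    nonempty S \<and> nonempty S' \<and> int_of (Addr S) = int_of (Addr S')"
  using assms eval_eq_iff[OF has_sort_Addr has_sort_Addr, of S S'] by (auto simp: Collide_def)

lemma eval_Guard:
  assumes "is_spatial L S" "is_spatial L S'"
  shows "eval L s (Guard \<Sigma>0 S S') = BoolV True \<longleftrightarrow>
    nonempty S \<and> nonempty S' \<and> int_of (Addr S) = int_of (Addr S') \<and>
    eval L s (Check \<Sigma>0 S S') = BoolV True"
  using assms by (auto simp: Guard_def eval_Collide)

lemma eval_Alloc_iff:
  assumes "is_spatial_conj L \<Sigma>" "has_sort L x IntS"
  shows "eval L s (Alloc \<Sigma> x) = BoolV True \<longleftrightarrow> int_of x \<in> addrs \<Sigma>"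
proof -
  have set: "set (enum \<Sigma>) = set_mset \<Sigma>"
    by (metis mset_enum set_mset_mset)
  have "eval L s (Alloc \<Sigma> x) = BoolV True \<longleftrightarrow>
      (\<exists>S \<in># \<Sigma>. eval L s (if S = Emp then PFalse else PAnd (PNot (Empty S)) (PEq x (Addr S))) =
        BoolV True)"
    by (simp only: Alloc_def Alloc_list_def eval_big_or set set_map bex_simps val.inject eq_True)
  also have "\<dots> \<longleftrightarrow> (\<exists>S \<in># \<Sigma>. S \<noteq> Emp \<and> nonempty S \<and> eval L s x = eval L s (Addr S))"
    by (intro bex_cong) auto
  also have "\<dots> \<longleftrightarrow> (\<exists>S \<in># \<Sigma>. nonempty S \<and> int_of x = int_of (Addr S))"
    using assms eval_eq_iff has_sort_Addr unfolding is_spatial_conj_def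
    by (metis nonempty_not_Emp)
  finally show ?thesis
    by (auto simp: addrs_def)
qed

lemma separated_WellFormed:
  assumes "is_spatial_conj L \<Sigma>" "eval L s (WellFormed \<Sigma>) = BoolV True"
  shows "separated \<Sigma>"
  unfolding separated_def
proof (intro allI impI notI, elim conjE)
  fix S \<Sigma>1
  assume \<Sigma>: "\<Sigma> = add_mset S \<Sigma>1" and S: "nonempty S" "int_of (Addr S) \<in> addrs \<Sigma>1"
  then obtain T where T: "T \<in># \<Sigma>1" "nonempty T" "int_of (Addr S) = int_of (Addr T)"
    by (auto simp: addrs_def)
  obtain Ss where Ss: "mset Ss = \<Sigma>1"
    using ex_mset by blast
  then obtain j where j: "j < length Ss" "Ss ! j = T"
    using T(1) by (metis in_set_conv_nth set_mset_mset)
  \<comment> \<open>As the enumeration is irrelevant, \<open>S\<close> may be listed first; the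
    collision then occurs at indices \<open>0\<close> and \<open>Suc j\<close>.\<close>
  have "eval L s (WellFormed_list (S # Ss)) = BoolV True"
    using assms(2) eval_WellFormed[of L s "S # Ss"] \<Sigma> Ss by simp
  then have "\<forall>j<length (S # Ss). \<forall>i<j. eval L s (Collide ((S # Ss) ! i) ((S # Ss) ! j)) \<noteq> BoolV True"
    by (simp only: eval_WellFormed_list val.inject)
  moreover have "Suc j < length (S # Ss)"
    using j by simp
  ultimately have "eval L s (Collide ((S # Ss) ! 0) ((S # Ss) ! Suc j)) \<noteq> BoolV True"
    by blast
  moreover have "is_spatial L S" "is_spatial L T"
    using assms(1) \<Sigma> T(1) by (auto simp: is_spatial_conj_def)
  ultimately show False
    using S T j by (simp add: eval_Collide)
qed

lemma separated_unionD: "separated (R + \<Sigma>) \<Longrightarrow> separated \<Sigma>"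
  unfolding separated_def by (metis UnI2 addrs_union union_mset_add_mset_right)

lemma is_heap_map_add: "is_heap L h1 \<Longrightarrow> is_heap L h2 \<Longrightarrow> is_heap L (h1 ++ h2)"
  by (fastforce simp: is_heap_def ran_def)

lemma is_heap_cell: "is_heap L [a \<mapsto> IntV b]"
  unfolding is_heap_def by (auto intro: exI[of _ IntS])

text \<open>One cell per nonempty predicate; separation makes their addresses distinct. By
  \<open>holds_addrs\<close> no model has a smaller domain.\<close>

lemma canonical_heap:
  assumes "is_spatial_conj L \<Sigma>" "separated \<Sigma>"
  obtains h where "is_heap L h" "holds h \<Sigma>" "dom h = addrs \<Sigma>"
proof -
  have "\<exists>h. is_heap L h \<and> holds h \<Sigma> \<and> dom h = addrs \<Sigma>"
    using assms
  proof (induction \<Sigma>)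
    case empty
    then show ?case by (simp add: is_heap_def)
  next
    case (add S \<Sigma>)
    then have "separated \<Sigma>"
      using separated_unionD[of "{#S#}"] by simp
    then obtain h where h: "is_heap L h" "holds h \<Sigma>" "dom h = addrs \<Sigma>"
      using add by auto
    show ?case
    proof (cases "nonempty S")
      case True
      let ?c = "[int_of (Addr S) \<mapsto> IntV (int_of (target S))] :: 'd heap"
      have "int_of (Addr S) \<notin> addrs \<Sigma>"
        using add.prems(2) True by (auto simp: separated_def)
      then have "holds (?c ++ h) (add_mset S \<Sigma>)"
        unfolding sat_spatial_formula_add_mset
        using h add.prems(1) True sat_cell by (intro exI[of _ ?c] exI[of _ h]) auto
      moreover have "dom (?c ++ h) = addrs (add_mset S \<Sigma>)"
        using h True by (auto simp: addrs_add_mset)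
      ultimately show ?thesis
        using h is_heap_map_add is_heap_cell by blast
    next
      case False
      then show ?thesis
        using h add.prems(1) holds_add_empty by (auto simp: addrs_add_mset)
    qed
  qed
  then show ?thesis using that by blast
qed


section \<open>Guarded steps and stuck states\<close>

text \<open>\<open>S\<close> covers an initial part of \<open>S'\<close> and
  \<open>Update S S'\<close> describes the rest. The premise \<open>outside\<close> is what excludes
  a premature visit to the end of \<open>S'\<close> when two segments are joined.\<close>

lemma guard_sound:
  assumes spatial: "is_spatial L S" "is_spatial L S'" "is_spatial_conj L \<Sigma>0"
    and guard: "eval L s (Guard \<Sigma>0 S S') = BoolV True"
    and sat: "sat_spatial L s h S" "sat_spatial L s g (Update S S')" "dom h \<inter> dom g = {}"
    and outside: "addrs \<Sigma>0 \<inter> dom h \<subseteq> {int_of (Addr S)}"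
  shows "sat_spatial L s (h ++ g) S'"
proof -
  have ne: "nonempty S" "nonempty S'" and eq: "int_of (Addr S) = int_of (Addr S')"
    and check: "eval L s (Check \<Sigma>0 S S') = BoolV True"
    using guard spatial by (simp_all add: eval_Guard)
  \<comment> \<open>An \<open>Lseg\<close> against a \<open>Next\<close> is excluded, because its
    check is false.\<close>
  consider (nn) x y x' z where "S = Next x y" "S' = Next x' z"
    | (nl) x y x' z where "S = Next x y" "S' = Lseg x' z"
    | (ll) x y x' z where "S = Lseg x y" "S' = Lseg x' z"
    using ne check by (cases S; cases S') auto
  then show ?thesis
  proof cases
    case nn
    then show ?thesis
      using sat eq check by simp
  next
    case nl
    have "h = [int_of x \<mapsto> IntV (int_of y)]" "list_segment (int_of y) (int_of z) g"
      "int_of x' \<noteq> int_of z"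
      using sat spatial ne nl sat_Next[of x y] sat_Lseg[of y z] nonempty_Lseg[of x' z] by auto
    then have "list_segment (int_of x') (int_of z) (h ++ g)"
      using list_segment.cons[of "int_of x'" "int_of z" g "int_of y"] sat(3) eq nl by auto
    then show ?thesis
      using nl spatial sat_Lseg by simp
  next
    case ll
    have h: "list_segment (int_of x) (int_of y) h" and g: "list_segment (int_of y) (int_of z) g"
      and x: "int_of x' \<noteq> int_of z" "int_of x = int_of x'"
      using sat spatial ne eq ll sat_Lseg[of x y] sat_Lseg[of y z] nonempty_Lseg[of x' z] by auto
    \<comment> \<open>Either \<open>z\<close> is already the end of the first segment, or
      \<open>Check\<close> makes it an address of \<open>\<Sigma>0\<close>. Then
      \<open>outside\<close> would force it to equal the address of \<open>S\<close>, contradicting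
      nonemptiness of \<open>S'\<close>.\<close>
    have "int_of z \<notin> dom h"
    proof (cases "int_of y = int_of z")
      case True
      then show ?thesis using h list_segment_end by metis
    next
      case False
      then have "int_of z \<in> addrs \<Sigma>0"
        using check ll spatial eval_Alloc_iff[of \<Sigma>0 z] by auto
      then show ?thesis
        using outside ll x by auto
    qed
    then have "list_segment (int_of x) (int_of z) (h ++ g)"
      using h g sat(3) list_segment_append by blast
    then show ?thesis
      using ll spatial sat_Lseg x by simp
  qed
qed

text \<open>Since \<open>S'\<close> is nonempty and starts at the address of \<open>S\<close>, it
  must own the prepended cell; cancelling that cell leaves a model of
  \<open>Update S S'\<close>.\<close>

lemma guard_complete:
  assumes spatial: "is_spatial L S" "is_spatial L S'"
    and guard: "eval L s (Guard \<Sigma>0 S S') = BoolV True"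
    and h: "int_of (Addr S) \<notin> dom h"
      "holds ([int_of (Addr S) \<mapsto> IntV (int_of (target S))] ++ h) (add_mset S' \<Sigma>')"
  shows "holds h (add_mset (Update S S') \<Sigma>')"
proof -
  have ne: "nonempty S" "nonempty S'" and eq: "int_of (Addr S) = int_of (Addr S')"
    and check: "eval L s (Check \<Sigma>0 S S') = BoolV True"
    using guard spatial by (simp_all add: eval_Guard)
  obtain h1 h2 where h12: "dom h1 \<inter> dom h2 = {}"
    "[int_of (Addr S) \<mapsto> IntV (int_of (target S))] ++ h = h1 ++ h2"
    "sat_spatial L s h1 S'" "holds h2 \<Sigma>'"
    using h(2) unfolding sat_spatial_formula_add_mset by blast
  show ?thesis
  proof (cases S')
    case (Next x' z)
    then have h1: "h1 = [int_of (Addr S) \<mapsto> IntV (int_of z)]"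
      using h12(3) spatial eq sat_Next[of x' z] by simp
    then have "int_of (Addr S) \<notin> dom h2"
      using h12(1) by simp
    then have "h = h2"
      using cell_add_eqD[OF h12(2)[unfolded h1] h(1)] by simp
    moreover have "Update S S' = Emp"
      using Next by (cases S) auto
    ultimately show ?thesis
      using h12(4) by (simp add: holds_add_empty)
  next
    case (Lseg x' z)
    then have "list_segment (int_of (Addr S)) (int_of z) h1" "int_of (Addr S) \<noteq> int_of z"
      using h12(3) spatial ne eq sat_Lseg[of x' z] nonempty_Lseg[of x' z] by auto
    then obtain c g where g: "h1 = [int_of (Addr S) \<mapsto> IntV c] ++ g"
      "int_of (Addr S) \<notin> dom g" "list_segment c (int_of z) g"
      by (rule list_segmentE)
    \<comment> \<open>The prepended cell is the first cell of the segment, so cancellation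
      identifies \<open>c\<close> with the target of \<open>S\<close> and \<open>h\<close> with the
      remainder.\<close>
    have "[int_of (Addr S) \<mapsto> IntV (int_of (target S))] ++ h = [int_of (Addr S) \<mapsto> IntV c] ++ (g ++ h2)"
      using h12(2) g(1) by simp
    moreover have "int_of (Addr S) \<notin> dom (g ++ h2)"
      using g h12(1) by auto
    ultimately have "int_of (target S) = c \<and> h = g ++ h2"
      using cell_add_eqD[OF _ h(1)] by fastforce
    then have c: "int_of (target S) = c" "h = g ++ h2"
      by simp_all
    have "Update S S' = Lseg (target S) z"
      using Lseg ne(1) by (cases S) auto
    moreover have "is_spatial L (Lseg (target S) z)"
      using Lseg ne(1) spatial by (cases S) auto
    ultimately have "sat_spatial L s g (Update S S')"
      using c(1) g(3) by (simp only: sat_Lseg)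
    moreover have "dom g \<inter> dom h2 = {}"
      using g(1) h12(1) by auto
    ultimately show ?thesis
      unfolding sat_spatial_formula_add_mset using c(2) h12(4) by blast
  qed (use ne in simp)
qed

text \<open>A segment \<open>S\<close> admits a path of length two through any \<open>f\<close>
  other than its ends, so \<open>f\<close> can be chosen to spoil \<open>S'\<close>: as a wrong
  content if \<open>S'\<close> is a \<open>Next\<close>, as a premature end if it is an
  \<open>Lseg\<close>.\<close>

lemma stuck_detour:
  assumes spatial: "is_spatial L S" "is_spatial L S'" "is_spatial_conj L \<Sigma>0"
    "is_spatial_conj L \<Sigma>'"
    and ne: "nonempty S" "nonempty S'" and eq: "int_of (Addr S) = int_of (Addr S')"
    and check: "eval L s (Check \<Sigma>0 S S') \<noteq> BoolV True"
    and h: "dom h \<subseteq> addrs \<Sigma>0" "int_of (Addr S) \<notin> dom h" "int_of (Addr S) \<in> addrs \<Sigma>0"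
    and canonical:
      "holds ([int_of (Addr S) \<mapsto> IntV (int_of (target S))] ++ h) (add_mset S' \<Sigma>')"
  obtains f where "f \<notin> addrs \<Sigma>0"
    "sat_spatial L s [int_of (Addr S) \<mapsto> IntV f, f \<mapsto> IntV (int_of (target S))] S"
    "\<not> holds ([int_of (Addr S) \<mapsto> IntV f, f \<mapsto> IntV (int_of (target S))] ++ h) (add_mset S' \<Sigma>')"
proof -
  define a b where "a = int_of (Addr S)" and "b = int_of (target S)"
  obtain p r where pr: "dom p \<inter> dom r = {}" "[a \<mapsto> IntV b] ++ h = p ++ r"
    "sat_spatial L s p S'" "holds r \<Sigma>'"
    using canonical unfolding sat_spatial_formula_add_mset a_def b_def by blast
  have a_h: "a \<notin> dom h" "a \<in> addrs \<Sigma>0"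
    using h a_def by auto
  have "a \<in> dom p"
    using pr(3) sat_nonempty_dom[of S' p] spatial ne eq by (simp add: a_def)
  then have a_r: "a \<notin> dom r"
    using pr(1) by blast
  \<comment> \<open>A \<open>Next\<close> would pass its check: trivially against an
    \<open>Lseg\<close>, and against a \<open>Next\<close> because both describe the same
    cell.\<close>
  have Lseg: "\<exists>x y. S = Lseg x y"
  proof (rule ccontr)
    assume "\<not> ?thesis"
    then obtain x y where S: "S = Next x y"
      using ne by (cases S) auto
    then obtain x' z where S': "S' = Next x' z"
      using check ne by (cases S') auto
    have "p = [a \<mapsto> IntV (int_of z)]"
      using pr(3) S' spatial eq sat_Next[of x' z] by (simp add: a_def)
    then have "IntV b = (IntV (int_of z) :: 'd val)"
      using pr(2) a_h(1) a_r cell_add_eqD by metis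
    then show False
      using check S S' spatial eval_eq_iff[of y z] by (simp add: b_def)
  qed
  then obtain x y where S: "S = Lseg x y"
    by blast
  have ab: "a = int_of x" "b = int_of y" "a \<noteq> b"
    using S ne spatial nonempty_Lseg[of x y] by (simp_all add: a_def b_def)
  have detour: "sat_spatial L s [a \<mapsto> IntV f, f \<mapsto> IntV b] S" if "f \<noteq> a" "f \<noteq> b" for f
  proof -
    have "list_segment a b ([a \<mapsto> IntV f] ++ [f \<mapsto> IntV b] :: 'd heap)"
      using that ab(3) list_segment_cell[of f b] by (intro list_segment.cons) simp_all
    moreover have "[a \<mapsto> IntV f] ++ [f \<mapsto> IntV b] = ([a \<mapsto> IntV f, f \<mapsto> IntV b] :: 'd heap)"
      by (simp add: map_add_def fun_eq_iff)
    ultimately show ?thesis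
      using S spatial sat_Lseg ab by simp
  qed
  show ?thesis
  proof (cases S')
    case (Next x' z)
    \<comment> \<open>Avoiding \<open>a\<close> and \<open>b\<close> makes the detour a segment;
      avoiding the value of \<open>z\<close> gives the cell at \<open>a\<close> a content that
      \<open>S'\<close> forbids.\<close>
    obtain f where f: "f \<notin> addrs \<Sigma>0 \<union> {a, b, int_of z}"
      using ex_new_if_finite[OF infinite_UNIV_int, of "addrs \<Sigma>0 \<union> {a, b, int_of z}"] finite_addrs
      by auto
    have "\<not> holds ([a \<mapsto> IntV f, f \<mapsto> IntV b] ++ h) (add_mset S' \<Sigma>')"
    proof
      assume "holds ([a \<mapsto> IntV f, f \<mapsto> IntV b] ++ h) (add_mset S' \<Sigma>')"
      then obtain p' r' where *: "dom p' \<inter> dom r' = {}"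
        "[a \<mapsto> IntV f, f \<mapsto> IntV b] ++ h = p' ++ r'" "sat_spatial L s p' S'"
        unfolding sat_spatial_formula_add_mset by blast
      have p': "p' = [a \<mapsto> IntV (int_of z)]"
        using *(3) Next spatial eq sat_Next[of x' z] by (simp add: a_def)
      have "r' a = None" "h a = None"
        using *(1) p' a_h(1) by auto
      then have "(p' ++ r') a = Some (IntV (int_of z))"
        "([a \<mapsto> IntV f, f \<mapsto> IntV b] ++ h) a = Some (IntV f)"
        using p' f by (auto simp: map_add_def)
      then show False
        using f *(2) by simp
    qed
    then show ?thesis
      using that[of f] f detour[of f] by (simp add: a_def b_def)
  next
    case (Lseg x' z)
    \<comment> \<open>The failed check says that the end of \<open>S'\<close> differs from
      \<open>b\<close> and is unallocated, so the detour may pass through it.\<close>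
    define f where "f = int_of z"
    have f: "f \<noteq> b" "f \<notin> addrs \<Sigma>0"
      using check S Lseg spatial eval_eq_iff[of y z] eval_Alloc_iff[of \<Sigma>0 z] ab
      by (auto simp: f_def)
    have "f \<noteq> a"
      using f a_h by auto
    \<comment> \<open>The detour through \<open>f\<close> cuts the part matched by \<open>S'\<close> down to one cell. By precision \<open>\<Sigma>'\<close>
      still occupies \<open>r\<close>, so nobody owns the cell at \<open>f\<close>.\<close>
    have "\<not> holds ([a \<mapsto> IntV f, f \<mapsto> IntV b] ++ h) (add_mset S' \<Sigma>')"
    proof
      let ?h = "[a \<mapsto> IntV f, f \<mapsto> IntV b] ++ h"
      assume "holds ?h (add_mset S' \<Sigma>')"
      then obtain p' r' where *: "dom p' \<inter> dom r' = {}"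
        "?h = p' ++ r'" "sat_spatial L s p' S'" "holds r' \<Sigma>'"
        unfolding sat_spatial_formula_add_mset by blast
      have "list_segment a f p'"
        using *(3) Lseg spatial eq sat_Lseg[of x' z] by (simp add: a_def f_def)
      then have "f \<notin> dom p'"
        using list_segment_end by blast
      moreover have "f \<in> dom ?h"
        by simp
      ultimately have "f \<in> dom r'"
        using *(2) by (metis Un_iff dom_map_add)
      moreover have "f \<notin> dom r"
      proof
        assume "f \<in> dom r"
        then have "f \<in> dom ([a \<mapsto> IntV b] ++ h)"
          using pr(2) by simp
        then show False
          using f h(1) \<open>f \<noteq> a\<close> by auto
      qed
      \<comment> \<open>The heaps before and after the detour agree off \<open>a\<close> and
        \<open>f\<close>, and \<open>r\<close> contains neither address.\<close>
      moreover have "r \<subseteq>\<^sub>m ?h"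
      proof -
        have "?h v = r v" if "v \<in> dom r" for v
        proof -
          have "v \<noteq> a" "v \<noteq> f"
            using that a_r \<open>f \<notin> dom r\<close> by auto
          then have "?h v = h v" "([a \<mapsto> IntV b] ++ h) v = h v"
            by (auto simp: map_add_def split: option.splits)
          then show ?thesis
            using pr(2) that by (metis map_add_dom_app_simps(1))
        qed
        then show ?thesis
          by (auto simp: map_le_def)
      qed
      moreover have "r' \<subseteq>\<^sub>m ?h"
        unfolding *(2) by simp
      ultimately show False
        using holds_precise[of \<Sigma>' r r' ?h] pr(4) *(4) spatial(4) by auto
    qed
    then show ?thesis
      using that[of f] f detour[of f] \<open>f \<noteq> a\<close> by (simp add: a_def b_def)
  qed (use ne in simp)
qed

text \<open>If no predicate of \<open>\<Sigma>\<close> starts at the address of a chosen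
  \<open>S'\<close>, the canonical heap lacks a cell required by \<open>S'\<close>; otherwise that
  heap or a detour works. Avoiding \<open>addrs R\<close> allows matched cells to be added back
  later.\<close>

lemma stuck_countermodel:
  assumes spatial: "is_spatial_conj L (R + \<Sigma>)" "is_spatial_conj L \<Sigma>'"
    and separated: "separated (R + \<Sigma>)"
    and ne: "\<forall>S \<in># \<Sigma>. nonempty S" "\<forall>S' \<in># \<Sigma>'. nonempty S'"
    and stuck: "\<forall>S \<in># \<Sigma>. \<forall>S' \<in># \<Sigma>'. eval L s (Guard (R + \<Sigma>) S S') \<noteq> BoolV True"
    and final: "\<not> (\<Sigma> = {#} \<and> \<Sigma>' = {#})"
  shows "\<exists>h. is_heap L h \<and> holds h \<Sigma> \<and> \<not> holds h \<Sigma>' \<and> dom h \<inter> addrs R = {}"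
proof -
  have sub: "addrs \<Sigma> \<inter> addrs R = {}"
  proof -
    have "a \<notin> addrs R" if a: "a \<in> addrs \<Sigma>" for a
    proof -
      obtain S where S: "S \<in># \<Sigma>" "nonempty S" "a = int_of (Addr S)"
        using a by (auto simp: addrs_def)
      obtain \<Sigma>1 where \<Sigma>1: "\<Sigma> = add_mset S \<Sigma>1"
        using S(1) by (meson multi_member_split)
      have "R + \<Sigma> = add_mset S (R + \<Sigma>1)"
        using \<Sigma>1 by simp
      then show ?thesis
        using separated S unfolding separated_def by (metis UnI1 addrs_union)
    qed
    then show ?thesis by blast
  qed
  have sep: "separated \<Sigma>"
    using separated separated_unionD by blast
  obtain h where h: "is_heap L h" "holds h \<Sigma>" "dom h = addrs \<Sigma>"
    using canonical_heap spatial sep by auto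
  show ?thesis
  proof (cases "\<Sigma>' = {#}")
    case True
    then obtain S where "S \<in># \<Sigma>"
      using final by auto
    then have "int_of (Addr S) \<in> dom h"
      using h(3) ne(1) by (auto simp: addrs_def)
    then have "h \<noteq> Map.empty"
      by auto
    then show ?thesis
      using h True sub by auto
  next
    case False
    then obtain S' \<Sigma>1' where \<Sigma>1': "\<Sigma>' = add_mset S' \<Sigma>1'"
      by (meson multiset_cases)
    have S': "nonempty S'" "is_spatial L S'"
      using \<Sigma>1' ne spatial by auto
    show ?thesis
    proof (cases "int_of (Addr S') \<in> addrs \<Sigma>")
      case False
      have "int_of (Addr S') \<in> addrs \<Sigma>'"
        using \<Sigma>1' S' by (simp add: addrs_add_mset)
      then have "\<not> holds h \<Sigma>'"
        using holds_addrs[of \<Sigma>' h] h(3) False spatial(2) by auto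
      then show ?thesis
        using h sub by auto
    next
      case True
      then obtain S where S: "S \<in># \<Sigma>" "int_of (Addr S) = int_of (Addr S')" "nonempty S"
        by (auto simp: addrs_def)
      then obtain \<Sigma>1 where \<Sigma>1: "\<Sigma> = add_mset S \<Sigma>1"
        by (meson multi_member_split)
      define a b where "a = int_of (Addr S)" and "b = int_of (target S)"
      have spS: "is_spatial L S"
        using \<Sigma>1 spatial by auto
      have "separated \<Sigma>1"
        using sep separated_unionD[of "{#S#}"] \<Sigma>1 by simp
      then obtain g where g: "is_heap L g" "holds g \<Sigma>1" "dom g = addrs \<Sigma>1"
        using canonical_heap[of \<Sigma>1] spatial \<Sigma>1 by auto
      have a_g: "a \<notin> dom g"
        using sep S(3) \<Sigma>1 g(3) unfolding separated_def a_def by blast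
      have a: "a \<in> addrs \<Sigma>"
        using S \<Sigma>1 by (simp add: addrs_add_mset a_def)
      have g_sub: "dom g \<subseteq> addrs \<Sigma>"
        using g \<Sigma>1 by (simp add: addrs_add_mset)
      \<comment> \<open>Covers both the canonical cell and the detour as the part of the heap owned
        by \<open>S\<close>.\<close>
      have heap: "holds (c ++ g) \<Sigma>" if "sat_spatial L s c S" "dom c \<inter> dom g = {}" for c
        unfolding \<Sigma>1 sat_spatial_formula_add_mset using that g(2) by blast
      have cell: "holds ([a \<mapsto> IntV b] ++ g) \<Sigma>"
        using sat_cell[OF spS S(3)] a_g by (intro heap) (auto simp: a_def b_def)
      show ?thesis
      proof (cases "holds ([a \<mapsto> IntV b] ++ g) \<Sigma>'")
        case False
        moreover have "is_heap L ([a \<mapsto> IntV b] ++ g)"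
          using g is_heap_map_add is_heap_cell by blast
        moreover have "dom ([a \<mapsto> IntV b] ++ g) \<inter> addrs R = {}"
          using a g_sub sub by auto
        ultimately show ?thesis
          using cell by blast
      next
        case True
        \<comment> \<open>Both predicates are nonempty and share their address, so only
          \<open>Check\<close> can make the guard fail.\<close>
        have check: "eval L s (Check (R + \<Sigma>) S S') \<noteq> BoolV True"
          using stuck S S' \<Sigma>1' spS by (auto simp: eval_Guard)
        have "is_spatial_conj L \<Sigma>1'" "dom g \<subseteq> addrs (R + \<Sigma>)" "a \<in> addrs (R + \<Sigma>)"
          using spatial(2) \<Sigma>1' g_sub a by (auto simp: addrs_union)
        then obtain f where f: "f \<notin> addrs (R + \<Sigma>)"
          "sat_spatial L s [a \<mapsto> IntV f, f \<mapsto> IntV b] S"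
          "\<not> holds ([a \<mapsto> IntV f, f \<mapsto> IntV b] ++ g) \<Sigma>'"
          using stuck_detour[OF spS S'(2) spatial(1) _ S(3) S'(1) S(2) check, of \<Sigma>1' g,
              folded a_def b_def \<Sigma>1'] a_g True by blast
        have "holds ([a \<mapsto> IntV f, f \<mapsto> IntV b] ++ g) \<Sigma>"
          using f a_g g_sub by (intro heap) (auto simp: addrs_union)
        moreover have "is_heap L ([a \<mapsto> IntV f, f \<mapsto> IntV b] ++ g)"
          using g is_heap_map_add[OF is_heap_map_add, of "[a \<mapsto> IntV f]" "[f \<mapsto> IntV b]" g]
            is_heap_cell by simp
        \<comment> \<open>The detour address avoids \<open>addrs R\<close> because the check refers
          to the initial conjunction \<open>R + \<Sigma>\<close>, not just to
          \<open>\<Sigma>\<close>.\<close>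
        moreover have "dom ([a \<mapsto> IntV f, f \<mapsto> IntV b] ++ g) \<inter> addrs R = {}"
          using f(1) a g_sub sub by (auto simp: addrs_union)
        ultimately show ?thesis
          using f(3) by blast
      qed
    qed
  qed
qed

end


section \<open>The matching procedure\<close>

text \<open>A guarded call shrinks only the left conjunction, as \<open>Update S S'\<close> takes
  the place of \<open>S'\<close>; the other calls remove one predicate.\<close>

lemma match_call_size:
  "match_call L s \<Sigma>0 c P c' \<Longrightarrow> size (fst c') + size (snd c') < size (fst c) + size (snd c)"
  by (induction rule: match_call.induct) (auto simp: size_Diff_singleton dest!: multi_member_split)

lemma match_steps: "match L s \<Sigma>0 \<Sigma> \<Sigma>' k U \<Longrightarrow> k \<le> size \<Sigma> + size \<Sigma>'"
  by (induction rule: match.induct) (auto dest: match_call_size)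

lemma match_terminates: "match_terminates L s \<Sigma>0 \<Sigma> \<Sigma>'"
  unfolding match_terminates_def
proof (intro notI, elim exE conjE)
  fix c
  assume "\<forall>i. \<exists>P. match_call L s \<Sigma>0 (c i) P (c (Suc i))"
  then have "(c (Suc i), c i) \<in> measure (\<lambda>(\<Sigma>, \<Sigma>'). size \<Sigma> + size \<Sigma>')" for i
    using match_call_size by (fastforce simp: case_prod_beta)
  then show False
    using wf_iff_no_infinite_down_chain[of "measure (\<lambda>(\<Sigma>, \<Sigma>'). size \<Sigma> + size \<Sigma>')"] by auto
qed

lemma match_total: "\<exists>k U. match L s \<Sigma>0 \<Sigma> \<Sigma>' k U"
proof (induction "size \<Sigma> + size \<Sigma>'" arbitrary: \<Sigma> \<Sigma>' rule: less_induct)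
  case less
  show ?case
  proof (cases "\<exists>P \<Sigma>1 \<Sigma>1'. match_call L s \<Sigma>0 (\<Sigma>, \<Sigma>') P (\<Sigma>1, \<Sigma>1')")
    case True
    then obtain P \<Sigma>1 \<Sigma>1' where call: "match_call L s \<Sigma>0 (\<Sigma>, \<Sigma>') P (\<Sigma>1, \<Sigma>1')"
      by blast
    then obtain k U where "match L s \<Sigma>0 \<Sigma>1 \<Sigma>1' k U"
      using less match_call_size by fastforce
    then show ?thesis
      using call match.recurse by blast
  next
    case False
    \<comment> \<open>Each rule assumes that the earlier ones fail, so the premises of
      \<open>return\<close> are obtained one after the other.\<close>
    then have "\<not> (\<exists>S \<in># \<Sigma>. models L s (Pure (Empty S)))"
      using match_call.empty_left by blast
    moreover from this have "\<not> (\<exists>S' \<in># \<Sigma>'. models L s (Pure (Empty S')))"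
      using False match_call.empty_right by blast
    moreover from calculation have "\<not> (\<exists>S \<in># \<Sigma>. \<exists>S' \<in># \<Sigma>'. models L s (Pure (Guard \<Sigma>0 S S')))"
      using False match_call.guard by blast
    ultimately show ?thesis
      using match.return by blast
  qed
qed

text \<open>Replaces multiset differences by \<open>add_mset\<close> equations, the form matching
  \<open>sat_spatial_formula_add_mset\<close>.\<close>

lemma match_callE [consumes 1, case_names empty_left empty_right guard]:
  assumes "match_call L s \<Sigma>0 (\<Sigma>, \<Sigma>') P (\<Sigma>1, \<Sigma>1')"
  obtains S where "\<Sigma> = add_mset S \<Sigma>1" "\<Sigma>1' = \<Sigma>'" "P = Empty S" "eval L s P = BoolV True"
  | S' where "\<Sigma>' = add_mset S' \<Sigma>1'" "\<Sigma>1 = \<Sigma>" "P = Empty S'" "eval L s P = BoolV True"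
  | S S' \<Sigma>2 where "\<Sigma> = add_mset S \<Sigma>1" "\<Sigma>' = add_mset S' \<Sigma>2"
      "\<Sigma>1' = add_mset (Update S S') \<Sigma>2" "P = Guard \<Sigma>0 S S'" "eval L s P = BoolV True"
  using assms by (cases rule: match_call.cases) (auto simp: models_Pure dest!: multi_member_split)

section \<open>Sort of the resulting formula\<close>

lemma has_sort_big_or: "\<forall>p \<in> set ps. has_sort L p BoolS \<Longrightarrow> has_sort L (big_or ps) BoolS"
  unfolding big_or_def by (induction ps) (auto intro: has_sort.intros)

lemma has_sort_Empty: "is_spatial L S \<Longrightarrow> has_sort L (Empty S) BoolS"
  by (cases S) (auto intro: has_sort.intros)

lemma has_sort_Alloc:
  assumes "is_spatial_conj L \<Sigma>" "has_sort L x IntS"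
  shows "has_sort L (Alloc \<Sigma> x) BoolS"
proof -
  have "set (enum \<Sigma>) = set_mset \<Sigma>"
    by (metis mset_enum set_mset_mset)
  moreover have "has_sort L (Addr S) IntS" if "S \<in># \<Sigma>" "S \<noteq> Emp" for S
    using assms(1) that unfolding is_spatial_conj_def by (cases S) fastforce+
  ultimately show ?thesis
    unfolding Alloc_def Alloc_list_def using assms
    by (intro has_sort_big_or)
      (auto simp: is_spatial_conj_def intro!: has_sort.intros intro: has_sort_Empty)
qed

lemma has_sort_Guard:
  assumes "is_spatial_conj L \<Sigma>0" "is_spatial L S" "is_spatial L S'"
  shows "has_sort L (Guard \<Sigma>0 S S') BoolS"
  using assms unfolding Guard_def Collide_def
  by (cases S; cases S') (auto intro!: has_sort.intros intro: has_sort_Alloc)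

lemma is_spatial_Update: "is_spatial L S \<Longrightarrow> is_spatial L S' \<Longrightarrow> is_spatial L (Update S S')"
  by (cases S; cases S') auto

lemma match_has_sort:
  assumes "match L s \<Sigma>0 \<Sigma> \<Sigma>' k U"
    and "is_spatial_conj L \<Sigma>0" "is_spatial_conj L \<Sigma>" "is_spatial_conj L \<Sigma>'"
  shows "has_sort L U BoolS"
  using assms
proof (induction rule: match.induct)
  case (return \<Sigma> \<Sigma>')
  then show ?case by (auto intro: has_sort.intros)
next
  case (recurse \<Sigma> \<Sigma>' P \<Sigma>1 \<Sigma>1' k U)
  from recurse.hyps(1) recurse.prems
  have "has_sort L P BoolS \<and> is_spatial_conj L \<Sigma>1 \<and> is_spatial_conj L \<Sigma>1'"
    by (cases rule: match_callE)
      (auto simp: is_spatial_conj_def has_sort_Empty has_sort_Guard is_spatial_Update)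
  then show ?case
    using recurse by (auto intro: has_sort.intros)
qed

section \<open>Correctness of the result\<close>

context language_stack
begin

text \<open>The stack \<open>t\<close> guiding the execution need not be the one the result is evaluated in.\<close>

lemma match_sound:
  assumes "match L t \<Sigma>0 \<Sigma> \<Sigma>' k U"
    and "is_spatial_conj L \<Sigma>0" "is_spatial_conj L \<Sigma>'" "\<Sigma>0 = R + \<Sigma>"
    and "eval L s U = BoolV True" "holds h \<Sigma>" "dom h \<inter> addrs R = {}"
  shows "holds h \<Sigma>'"
  using assms
proof (induction arbitrary: R h rule: match.induct)
  case (return \<Sigma> \<Sigma>')
  then show ?case by (auto split: if_splits)
next
  case (recurse \<Sigma> \<Sigma>' P \<Sigma>1 \<Sigma>1' k U)
  \<comment> \<open>The run only guarantees \<open>P\<close> in \<open>t\<close>; its truth in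
    \<open>s\<close> is extracted from the returned conjunction.\<close>
  have P: "eval L s P = BoolV True" and U: "eval L s U = BoolV True"
    using recurse.prems(4) by auto
  note IH = recurse.IH[OF recurse.prems(1) _ _ U]
  note prems = recurse.prems
  from recurse.hyps(1) show ?case
  proof (cases rule: match_callE)
    case (empty_left S)
    then show ?thesis
      using IH[of "add_mset S R" h] prems P by (auto simp: addrs_add_mset holds_add_empty)
  next
    case (empty_right S')
    then show ?thesis
      using IH[of R h] prems P by (auto simp: holds_add_empty)
  next
    case (guard S S' \<Sigma>2)
    have spatial: "is_spatial L S" "is_spatial L S'" "is_spatial_conj L \<Sigma>2" "is_spatial_conj L \<Sigma>1"
      using guard prems(1,2,3) by auto
    obtain h1 h2 where h12: "dom h1 \<inter> dom h2 = {}" "h = h1 ++ h2" "sat_spatial L s h1 S"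
      "holds h2 \<Sigma>1"
      using prems(5) unfolding guard(1) sat_spatial_formula_add_mset by blast
    have ne: "nonempty S"
      using P guard(4) spatial by (simp add: eval_Guard)
    have "int_of (Addr S) \<in> dom h1"
      using sat_nonempty_dom spatial(1) ne h12(3) by blast
    \<comment> \<open>Moving \<open>S\<close> to \<open>R\<close> preserves the invariant, since the
      address of \<open>S\<close> lies in \<open>h1\<close>.\<close>
    then have "dom h2 \<inter> addrs (add_mset S R) = {}"
      using h12(1,2) prems(6) by (auto simp: addrs_add_mset)
    then have "holds h2 \<Sigma>1'"
      using IH[of "add_mset S R" h2] prems(3) guard h12(4) spatial
        is_spatial_Update[OF spatial(1,2)] by auto
    then obtain g1 g2 where g12: "dom g1 \<inter> dom g2 = {}" "h2 = g1 ++ g2"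
      "sat_spatial L s g1 (Update S S')" "holds g2 \<Sigma>2"
      unfolding guard(3) sat_spatial_formula_add_mset by blast
    \<comment> \<open>The other addresses of \<open>\<Sigma>0\<close> come from \<open>R\<close>,
      which \<open>h\<close> avoids, or from \<open>\<Sigma>1\<close>, whose addresses lie in
      \<open>h2\<close>.\<close>
    have "addrs \<Sigma>0 \<inter> dom h1 \<subseteq> {int_of (Addr S)}"
      using prems(3,6) guard(1) h12(1,2) holds_addrs[OF spatial(4) h12(4)]
      by (auto simp: addrs_union addrs_add_mset)
    then have "sat_spatial L s (h1 ++ g1) S'"
      using guard_sound[of S S' \<Sigma>0 h1 g1] spatial prems(1) P guard(4) h12 g12 by auto
    moreover have "dom (h1 ++ g1) \<inter> dom g2 = {}" "h = (h1 ++ g1) ++ g2"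
      using h12 g12 by auto
    ultimately show ?thesis
      unfolding guard(2) sat_spatial_formula_add_mset using g12(4) by blast
  qed
qed

text \<open>The same stack drives the run and evaluates \<open>U\<close>, so every \<open>P\<close>
  is true and a false conjunction means a false recursive result. Its countermodel avoids the
  address of \<open>S\<close> and can be extended there by one cell.\<close>

lemma match_complete:
  assumes "match L s \<Sigma>0 \<Sigma> \<Sigma>' k U"
    and "is_spatial_conj L \<Sigma>0" "is_spatial_conj L \<Sigma>'" "separated \<Sigma>0" "\<Sigma>0 = R + \<Sigma>"
    and "eval L s U \<noteq> BoolV True"
  shows "\<exists>h. is_heap L h \<and> holds h \<Sigma> \<and> \<not> holds h \<Sigma>' \<and> dom h \<inter> addrs R = {}"
  using assms
proof (induction arbitrary: R rule: match.induct)
  case (return \<Sigma> \<Sigma>')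
  then show ?case
    by (intro stuck_countermodel) (auto simp: models_Pure)
next
  case (recurse \<Sigma> \<Sigma>' P \<Sigma>1 \<Sigma>1' k U)
  note prems = recurse.prems
  from recurse.hyps(1) show ?case
  proof (cases rule: match_callE)
    case (empty_left S)
    then show ?thesis
      using recurse.IH[of "add_mset S R"] prems by (auto simp: addrs_add_mset holds_add_empty)
  next
    case (empty_right S')
    then show ?thesis
      using recurse.IH[of R] prems by (auto simp: holds_add_empty)
  next
    case (guard S S' \<Sigma>2)
    have spatial: "is_spatial L S" "is_spatial L S'" "is_spatial_conj L \<Sigma>2"
      using guard prems(1,2,4) by auto
    have ne: "nonempty S"
      using guard(4,5) spatial by (simp add: eval_Guard)
    obtain h where h: "is_heap L h" "holds h \<Sigma>1" "\<not> holds h \<Sigma>1'"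
      "dom h \<inter> addrs (add_mset S R) = {}"
      using recurse.IH[of "add_mset S R"] prems guard spatial is_spatial_Update[OF spatial(1,2)]
      by auto
    let ?c = "[int_of (Addr S) \<mapsto> IntV (int_of (target S))] :: 'd heap"
    have notin: "int_of (Addr S) \<notin> dom h"
      using h(4) ne by (auto simp: addrs_add_mset)
    \<comment> \<open>By contraposition of \<open>guard_complete\<close>: a model of
      \<open>\<Sigma>'\<close> would yield one of \<open>\<Sigma>1'\<close> after removing the
      cell.\<close>
    have "\<not> holds (?c ++ h) \<Sigma>'"
      using guard_complete[of S S' \<Sigma>0 h \<Sigma>2] spatial guard notin h(3) by auto
    moreover have "holds (?c ++ h) \<Sigma>"
      unfolding guard(1) sat_spatial_formula_add_mset
      using sat_cell[OF spatial(1) ne] h(2) notin by (intro exI[of _ ?c] exI[of _ h]) auto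
    moreover have "int_of (Addr S) \<notin> addrs R"
    proof -
      have "\<Sigma>0 = add_mset S (R + \<Sigma>1)"
        using prems(4) guard(1) by simp
      then show ?thesis
        using prems(3) ne unfolding separated_def by (metis UnI1 addrs_union)
    qed
    then have "dom (?c ++ h) \<inter> addrs R = {}"
      using h(4) by (auto simp: addrs_add_mset)
    moreover have "is_heap L (?c ++ h)"
      using h is_heap_map_add is_heap_cell by blast
    ultimately show ?thesis
      by blast
  qed
qed

end

theorem theorem2:
  fixes L :: "('x, 'f, 'k, 'd) language"
  assumes "is_language L"
  shows "\<exists>T :: nat \<Rightarrow> real. T \<in> O(\<lambda>n. real n) \<and>
    (\<forall>s \<Sigma> \<Sigma>'. is_stack L s \<and> is_spatial_conj L \<Sigma> \<and> is_spatial_conj L \<Sigma>' \<and>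
       models L s (Pure (WellFormed \<Sigma>)) \<longrightarrow>
         match_terminates L s \<Sigma> \<Sigma> \<Sigma>' \<and>
         (\<exists>k U. match L s \<Sigma> \<Sigma> \<Sigma>' k U) \<and>
         (\<forall>k U. match L s \<Sigma> \<Sigma> \<Sigma>' k U \<longrightarrow>
            has_sort L U BoolS \<and>
            real k \<le> T (size \<Sigma> + size \<Sigma>') \<and>
            (models L s (Pure U) \<longrightarrow>
               valid L (FImp (FAnd (Pure U) (spatial_formula \<Sigma>)) (spatial_formula \<Sigma>'))) \<and>
            (\<not> models L s (Pure U) \<longrightarrow>
               \<not> models L s (FImp (spatial_formula \<Sigma>) (spatial_formula \<Sigma>')) \<and>
               (\<exists>h. is_heap L h \<and> sat L s h (spatial_formula \<Sigma>) \<and>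
                  \<not> sat L s h (spatial_formula \<Sigma>')))))"
\<comment> \<open>The bound \<open>T\<close> is the identity \<open>real\<close>, as there is at
  most one call per predicate.\<close>
proof (intro exI[of _ real] conjI allI impI; (elim conjE)?)
  fix s \<Sigma> \<Sigma>'
  assume stack: "is_stack L s" and \<Sigma>: "is_spatial_conj L \<Sigma>" and \<Sigma>': "is_spatial_conj L \<Sigma>'"
    and wf: "models L s (Pure (WellFormed \<Sigma>))"
  show "match_terminates L s \<Sigma> \<Sigma> \<Sigma>'"
    by (rule match_terminates)
  show "\<exists>k U. match L s \<Sigma> \<Sigma> \<Sigma>' k U"
    by (rule match_total)
  fix k U
  assume match: "match L s \<Sigma> \<Sigma> \<Sigma>' k U"
  show "has_sort L U BoolS"
    using match_has_sort match \<Sigma> \<Sigma>' by blast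
  show "real k \<le> real (size \<Sigma> + size \<Sigma>')"
    using match_steps match by (metis of_nat_le_iff)
  show "valid L (FImp (FAnd (Pure U) (spatial_formula \<Sigma>)) (spatial_formula \<Sigma>'))"
    unfolding valid_def
  proof (intro allI impI, elim conjE)
    fix s' h
    assume "is_stack L s'"
    \<comment> \<open>Validity concerns every stack \<open>s'\<close>, so soundness is applied to
      \<open>s'\<close> with the run guided by \<open>s\<close>; initially \<open>R\<close> is
      \<open>{#}\<close>.\<close>
    then interpret language_stack L s'
      using assms by unfold_locales
    show "sat L s' h (FImp (FAnd (Pure U) (spatial_formula \<Sigma>)) (spatial_formula \<Sigma>'))"
      using match_sound[OF match \<Sigma> \<Sigma>', of "{#}" h] by simp
  qed
  assume "\<not> models L s (Pure U)"
  then have U: "eval L s U \<noteq> BoolV True"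
    by (simp add: models_Pure)
  interpret language_stack L s
    using assms stack by unfold_locales
  have "separated \<Sigma>"
    using separated_WellFormed \<Sigma> wf by (simp add: models_Pure)
  then show "\<exists>h. is_heap L h \<and> sat L s h (spatial_formula \<Sigma>) \<and> \<not> sat L s h (spatial_formula \<Sigma>')"
    using match_complete[OF match \<Sigma> \<Sigma>', of "{#}"] U by auto
  then show "\<not> models L s (FImp (spatial_formula \<Sigma>) (spatial_formula \<Sigma>'))"
    by (auto simp: models_def)
qed simp

end
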